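(* Let $d\ge1$, let $\mathbb{B}_1$ be the open unit ball of $\mathbb{R}^d$, and let $B>0$ and $T\ge 0$. Then the eigenvalue problem $$B\Delta^2\phi-T\Delta\phi=\mu\phi \ \text{ in } \mathbb{B}_1, \qquad \phi=\partial_n\phi=0 \ \text{ on } \partial\mathbb{B}_1,$$ has an eigenvalue $\mu_1>0$ with a corresponding radially symmetric eigenfunction $\phi_1>0$ in $\mathbb{B}_1$, and $\mu_1$ is the only eigenvalue with a positive radially symmetric eigenfunction. Moreover, any radially symmetric eigenfunction corresponding to the eigenvalue $\mu_1$ is a scalar multiple of $\phi_1$.
   Context: $\partial_n\phi$ denotes the outward normal derivative of $\phi$ on $\partial\mathbb{B}_1$. *)

theory Defs
  imports "HOL-Analysis.Analysis"
begin

(* R^d is an arbitrary type 'a :: euclidean_space with d = DIM('a) \<ge> 1, and B_1 is ball 0 1.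
   Functions on the closed unit ball are total functions on 'a; their values outside cball 0 1
   play no role in any of the notions below. *)

definition partial :: "'a::euclidean_space \<Rightarrow> ('a \<Rightarrow> real) \<Rightarrow> 'a \<Rightarrow> real" where
  "partial i f x = frechet_derivative f (at x) i"

(* Meant for open S only, where it is the usual class C^k(S). *)
fun Ck_on_open :: "nat \<Rightarrow> ('a::euclidean_space \<Rightarrow> real) \<Rightarrow> 'a set \<Rightarrow> bool" where
  "Ck_on_open 0 f S \<longleftrightarrow> continuous_on S f"
| "Ck_on_open (Suc k) f S \<longleftrightarrow>
     (\<forall>x\<in>S. f differentiable (at x)) \<and> (\<forall>i\<in>Basis. Ck_on_open k (partial i f) S)"

(* C^1 up to the boundary; G is the continuous extension of the gradient to the closed ball. *)
definition C1_closed_ball :: "('a::euclidean_space \<Rightarrow> real) \<Rightarrow> bool" where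
  "C1_closed_ball f \<longleftrightarrow>
     (\<exists>G. continuous_on (cball 0 1) G \<and>
          (\<forall>x\<in>cball 0 1. (f has_derivative (\<lambda>h. G x \<bullet> h)) (at x within cball 0 1)))"

definition laplacian :: "('a::euclidean_space \<Rightarrow> real) \<Rightarrow> 'a \<Rightarrow> real" where
  "laplacian f x = (\<Sum>i\<in>Basis. partial i (partial i f) x)"

(* The outward unit normal of the unit ball at a point x with norm x = 1 is x itself. The
   derivative is one-sided, taken from inside the ball. *)
definition has_outward_normal_derivative ::
    "('a::euclidean_space \<Rightarrow> real) \<Rightarrow> real \<Rightarrow> 'a \<Rightarrow> bool" where
  "has_outward_normal_derivative f D x \<longleftrightarrow>
     ((\<lambda>t. f (x + t *\<^sub>R x)) has_real_derivative D) (at_left 0)"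

(* Nontrivial classical solutions, in C^4(B_1) and C^1 up to the boundary. *)
definition eigenfunction ::
    "real \<Rightarrow> real \<Rightarrow> real \<Rightarrow> ('a::euclidean_space \<Rightarrow> real) \<Rightarrow> bool" where
  "eigenfunction B T \<mu> \<phi> \<longleftrightarrow>
     Ck_on_open 4 \<phi> (ball 0 1) \<and> C1_closed_ball \<phi> \<and>
     (\<exists>x\<in>ball 0 1. \<phi> x \<noteq> 0) \<and>
     (\<forall>x\<in>ball 0 1. B * laplacian (laplacian \<phi>) x - T * laplacian \<phi> x = \<mu> * \<phi> x) \<and>
     (\<forall>x\<in>sphere 0 1. \<phi> x = 0 \<and> has_outward_normal_derivative \<phi> 0 x)"

definition eigenvalue :: "'a::euclidean_space itself \<Rightarrow> real \<Rightarrow> real \<Rightarrow> real \<Rightarrow> bool" where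
  "eigenvalue _ B T \<mu> \<longleftrightarrow> (\<exists>\<phi> :: 'a \<Rightarrow> real. eigenfunction B T \<mu> \<phi>)"

(* For DIM('a) = 1 this means that f is even. *)
definition radially_symmetric :: "('a::euclidean_space \<Rightarrow> real) \<Rightarrow> bool" where
  "radially_symmetric f \<longleftrightarrow> (\<forall>x\<in>cball 0 1. \<forall>y\<in>cball 0 1. norm x = norm y \<longrightarrow> f x = f y)"

end

theory Submission
  imports Defs
begin

text \<open>
  Put \<open>\<tau> = T/B\<close>. For \<open>s > 0\<close> the operator \<open>\<Delta>\<^sup>2 - \<tau> \<Delta> - s (s + \<tau>)\<close> factors as
  \<open>(\<Delta> + s) (\<Delta> - (s + \<tau>))\<close>. Its radial solutions that are smooth at the origin are spanned by the
  two functions \<open>F(-s \<bar>x\<bar>\<^sup>2)\<close> and \<open>F((s + \<tau>) \<bar>x\<bar>\<^sup>2)\<close>, where \<open>F\<close> is the entire Bessel series of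
  index \<open>d/2\<close>.

  Existence. A combination \<open>g(\<bar>x\<bar>\<^sup>2)\<close> with \<open>g t = F(-s t) + c F((s + \<tau>) t)\<close> is an eigenfunction as
  soon as \<open>g 1 = g' 1 = 0\<close>. The intermediate value theorem yields such an \<open>s\<close> below the first zero of
  \<open>F'(-x)\<close>, with \<open>c > 0\<close> (lemma \<open>clamped_profile\<close>; that \<open>F'(-x)\<close> has a zero is
  \<open>bessel_series_oscillates\<close>). In that range \<open>F''\<close> is positive, so \<open>g\<close> is strictly convex on
  \<open>[0, 1]\<close> and hence positive before its double zero at 1.

  Uniqueness of the eigenvalue. Two positive radial eigenfunctions with different eigenvalues
  contradict Green's identity (\<open>clamped_radial_system_not_less\<close>). Eigenfunctions are only \<open>C\<^sup>1\<close> up to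
  the boundary, so the boundary terms with \<open>\<Delta>u\<close> and its derivative could a priori blow up; they
  stay bounded because the profile solves a linear system that is regular at \<open>r = 1\<close>
  (\<open>radial_system_energy_bound\<close>). The argument covers eigenvalues of
  either sign, so it also excludes nonpositive ones.

  Simplicity. The same energy bound shows that a smooth radial solution is determined by its value and
  the value of its Laplacian at the origin, so it is a combination of the two Bessel profiles, and the
  condition at \<open>r = 1\<close> leaves one free constant.
\<close>

section \<open>Bessel functions as an entire series\<close>

text \<open>
  This is the hypergeometric series \<open>0F1(; \<nu>; s/4)\<close>. Up to a constant and a power of
  \<open>\<bar>s\<bar>\<close> it is the Bessel function of order \<open>\<nu> - 1\<close> at \<open>sqrt (-s)\<close> for \<open>s < 0\<close>, and the
  modified Bessel function of that order at \<open>sqrt s\<close> for \<open>s > 0\<close>. Having both in one function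
  that is analytic through \<open>s = 0\<close> makes \<open>F(l \<bar>x\<bar>\<^sup>2)\<close> smooth at the origin, and it solves
  \<open>\<Delta>v = l v\<close> for either sign of \<open>l\<close> when \<open>\<nu> = d/2\<close>.
\<close>
definition bessel_series :: "real \<Rightarrow> real \<Rightarrow> real" where
  "bessel_series \<nu> s = (\<Sum>k. 1 / (4 ^ k * fact k * pochhammer \<nu> k) * s ^ k)"

lemma summable_bessel_series:
  fixes \<nu> s :: real
  assumes "\<nu> > 0"
  shows "summable (\<lambda>k. 1 / (4 ^ k * fact k * pochhammer \<nu> k) * s ^ k)"
proof -
  obtain N :: nat where N: "real N \<ge> \<bar>s\<bar> / \<nu>"
    using real_arch_simple by blast
  have "norm (1 / (4 ^ Suc k * fact (Suc k) * pochhammer \<nu> (Suc k)) * s ^ Suc k)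
      \<le> 1/4 * norm (1 / (4 ^ k * fact k * pochhammer \<nu> k) * s ^ k)" if "k \<ge> N" for k
  proof -
    have p: "pochhammer \<nu> k > 0" using assms by (rule pochhammer_pos)
    have "\<bar>s\<bar> \<le> \<nu> * real k"
      using N that assms by (smt (verit) of_nat_mono pos_divide_le_eq mult.commute)
    also have "\<dots> \<le> (\<nu> + real k) * (1 + real k)"
      using assms by (simp add: algebra_simps)
    finally have "\<bar>s\<bar> / ((\<nu> + real k) * (1 + real k)) \<le> 1"
      using assms by (simp add: divide_le_eq)
    then have *: "\<bar>s\<bar> / ((\<nu> + real k) * (1 + real k)) * (\<bar>s\<bar> ^ k / (4 ^ k * fact k * pochhammer \<nu> k))
      \<le> 1 * (\<bar>s\<bar> ^ k / (4 ^ k * fact k * pochhammer \<nu> k))"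
      using p by (intro mult_right_mono) auto
    have "norm (1 / (4 ^ Suc k * fact (Suc k) * pochhammer \<nu> (Suc k)) * s ^ Suc k)
      = 1/4 * (\<bar>s\<bar> / ((\<nu> + real k) * (1 + real k)) * (\<bar>s\<bar> ^ k / (4 ^ k * fact k * pochhammer \<nu> k)))"
      using p assms by (simp add: abs_mult power_abs pochhammer_Suc)
    also have "\<dots> \<le> 1/4 * (\<bar>s\<bar> ^ k / (4 ^ k * fact k * pochhammer \<nu> k))"
      by (rule order_trans[OF mult_left_mono[OF *]]) auto
    also have "\<dots> = 1/4 * norm (1 / (4 ^ k * fact k * pochhammer \<nu> k) * s ^ k)"
      using p by (simp add: abs_mult power_abs)
    finally show ?thesis .
  qed
  then show ?thesis by (intro summable_ratio_test[where c = "1/4" and N = N]) auto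
qed

lemma bessel_series_0 [simp]: "bessel_series \<nu> 0 = 1"
  unfolding bessel_series_def
  using powser_zero[of "\<lambda>k. 1 / (4 ^ k * fact k * pochhammer \<nu> k)"] by simp

lemma bessel_series_pos:
  assumes "\<nu> > 0" and "s \<ge> 0"
  shows "bessel_series \<nu> s > 0"
  unfolding bessel_series_def
proof (rule suminf_pos2[where i = 0])
  show "0 \<le> 1 / (4 ^ k * fact k * pochhammer \<nu> k) * s ^ k" for k
    using assms pochhammer_pos[of \<nu> k] by simp
qed (use summable_bessel_series[OF assms(1)] in auto)

lemma DERIV_bessel_series:
  assumes "\<nu> > 0"
  shows "(bessel_series \<nu> has_real_derivative bessel_series (\<nu> + 1) s / (4 * \<nu>)) (at s)"
proof -
  let ?c = "\<lambda>\<nu> k. 1 / (4 ^ k * fact k * pochhammer \<nu> k) :: real"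
  have d: "diffs (?c \<nu>) = (\<lambda>k. 1 / (4 * \<nu>) * ?c (\<nu> + 1) k)"
  proof
    fix k
    have "pochhammer (\<nu> + 1) k > 0" using assms by (intro pochhammer_pos) auto
    then show "diffs (?c \<nu>) k = 1 / (4 * \<nu>) * ?c (\<nu> + 1) k"
      using assms by (simp add: diffs_def pochhammer_rec divide_simps)
  qed
  have "((\<lambda>x. \<Sum>k. ?c \<nu> k * x ^ k) has_real_derivative (\<Sum>k. diffs (?c \<nu>) k * s ^ k)) (at s)"
    by (rule termdiffs_strong_converges_everywhere) (rule summable_bessel_series[OF assms])
  also have "(\<Sum>k. diffs (?c \<nu>) k * s ^ k) = (\<Sum>k. 1 / (4 * \<nu>) * (?c (\<nu> + 1) k * s ^ k))"
    unfolding d by (simp add: mult.assoc)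
  also have "\<dots> = bessel_series (\<nu> + 1) s / (4 * \<nu>)"
    unfolding bessel_series_def using assms summable_bessel_series[of "\<nu> + 1" s]
    by (subst suminf_mult) auto
  finally show ?thesis by (simp add: bessel_series_def[abs_def])
qed

lemma DERIV_bessel_series_chain [derivative_intros]:
  assumes "\<nu> > 0" and "(f has_real_derivative D) (at x within S)"
  shows "((\<lambda>x. bessel_series \<nu> (f x)) has_real_derivative
          bessel_series (\<nu> + 1) (f x) / (4 * \<nu>) * D) (at x within S)"
  using DERIV_chain2[OF DERIV_bessel_series[OF assms(1)] assms(2)] .

lemma continuous_on_bessel_series [continuous_intros]:
  assumes "\<nu> > 0" and "continuous_on S f"
  shows "continuous_on S (\<lambda>x. bessel_series \<nu> (f x))"
proof -
  have "continuous_on UNIV (bessel_series \<nu>)"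
    using DERIV_bessel_series[OF assms(1)] DERIV_isCont continuous_at_imp_continuous_on by blast
  then show ?thesis using assms(2) continuous_on_compose2 by blast
qed

text \<open>
  Since differentiation raises the index, this relation is the differential equation
  \<open>4 s F'' + 4 \<nu> F' = F\<close>, in a form free of derivatives. It holds coefficient by coefficient,
  because \<open>1/(\<nu>)\<^sub>k - 1/(\<nu>+1)\<^sub>k = k / (\<nu> (\<nu>+1)\<^sub>k)\<close> for the rising factorials.
\<close>
lemma bessel_series_contiguous:
  assumes "\<nu> > 0"
  shows "bessel_series \<nu> s
    = bessel_series (\<nu> + 1) s + s * bessel_series (\<nu> + 2) s / (4 * \<nu> * (\<nu> + 1))"
proof -
  let ?c = "\<lambda>\<nu> k. 1 / (4 ^ k * fact k * pochhammer \<nu> k) :: real"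
  have sums: "(\<lambda>k. ?c a k * s ^ k) sums bessel_series a s" if "a > 0" for a
    unfolding bessel_series_def using summable_bessel_series[OF that] by (rule summable_sums)
  let ?h = "\<lambda>k. ?c \<nu> k * s ^ k - ?c (\<nu> + 1) k * s ^ k"
  have "(\<lambda>k. s / (4 * \<nu> * (\<nu> + 1)) * (?c (\<nu> + 2) k * s ^ k))
      sums (s / (4 * \<nu> * (\<nu> + 1)) * bessel_series (\<nu> + 2) s)"
    using assms by (intro sums_mult sums) auto
  moreover have "?h (Suc k) = s / (4 * \<nu> * (\<nu> + 1)) * (?c (\<nu> + 2) k * s ^ k)" for k
  proof -
    have a: "pochhammer (\<nu> + 2) k > 0" using assms by (intro pochhammer_pos) auto
    have b: "pochhammer (\<nu> + 1) (Suc k) = (\<nu> + 1) * pochhammer (\<nu> + 2) k"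
      by (simp add: pochhammer_rec add.commute add.left_commute)
    have c: "(\<nu> + 1 + real k) * pochhammer \<nu> (Suc k) = \<nu> * pochhammer (\<nu> + 1) (Suc k)"
      using pochhammer_rec[of \<nu> "Suc k"] pochhammer_Suc[of \<nu> "Suc k"] by (simp add: algebra_simps)
    have e: "\<nu> + 1 + real k \<noteq> 0" using assms by simp
    have f: "pochhammer \<nu> (Suc k) = \<nu> * ((\<nu> + 1) * pochhammer (\<nu> + 2) k) / (\<nu> + 1 + real k)"
      using c b e by (simp add: field_simps)
    have "1 / pochhammer \<nu> (Suc k) - 1 / pochhammer (\<nu> + 1) (Suc k)
        = (\<nu> + 1 + real k) / (\<nu> * ((\<nu> + 1) * pochhammer (\<nu> + 2) k)) - 1 / ((\<nu> + 1) * pochhammer (\<nu> + 2) k)"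
      unfolding f b by simp
    also have "\<dots> = real (Suc k) / (\<nu> * (\<nu> + 1) * pochhammer (\<nu> + 2) k)"
      using a assms by (simp add: divide_simps)
    finally have g: "1 / pochhammer \<nu> (Suc k) - 1 / pochhammer (\<nu> + 1) (Suc k)
      = real (Suc k) / (\<nu> * (\<nu> + 1) * pochhammer (\<nu> + 2) k)" .
    have "?h (Suc k) = (1 / pochhammer \<nu> (Suc k) - 1 / pochhammer (\<nu> + 1) (Suc k))
        * s ^ Suc k / (4 ^ Suc k * fact (Suc k))"
      by (simp only: divide_inverse inverse_mult_distrib mult_1 algebra_simps)
    also have "\<dots> = s / (4 * \<nu> * (\<nu> + 1)) * (?c (\<nu> + 2) k * s ^ k)"
      unfolding g using a assms by (simp del: of_nat_Suc)
    finally show ?thesis .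
  qed
  ultimately have "?h sums (s / (4 * \<nu> * (\<nu> + 1)) * bessel_series (\<nu> + 2) s + ?h 0)"
    by (intro sums_Suc_iff[THEN iffD1]) simp
  moreover have "?h sums (bessel_series \<nu> s - bessel_series (\<nu> + 1) s)"
    using assms by (intro sums_diff sums) auto
  ultimately show ?thesis
    using sums_unique2[of ?h] by fastforce
qed

text \<open>
  As the derivative of \<open>x\<^sup>\<nu> F\<^bsub>\<nu>+1\<^esub>(-x)\<close> is \<open>\<nu> x\<^bsup>\<nu>-1\<^esup> F\<^bsub>\<nu>\<^esub>(-x)\<close>, that product increases
  from 0 as long as \<open>F\<^bsub>\<nu>\<^esub>(-x)\<close> is positive: a zero of \<open>F\<^bsub>\<nu>\<^esub>\<close> on the negative axis comes
  strictly before the first one of \<open>F\<^bsub>\<nu>+1\<^esub>\<close>.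
\<close>
lemma bessel_series_shift_pos:
  assumes "\<nu> > 0" and pos: "\<And>x. 0 \<le> x \<Longrightarrow> x < q \<Longrightarrow> bessel_series \<nu> (-x) > 0" and "0 \<le> x" "x \<le> q"
  shows "bessel_series (\<nu> + 1) (-x) > 0"
proof (cases "x = 0")
  case False
  then have "x > 0" using assms by simp
  let ?f = "\<lambda>x. x powr \<nu> * bessel_series (\<nu> + 1) (-x)"
  have "?f 0 < ?f x"
  proof (rule DERIV_pos_imp_increasing_open[OF \<open>x > 0\<close>])
    fix y assume y: "0 < y" "y < x"
    have p: "y powr \<nu> = y * y powr (\<nu> - 1)" using y by (simp add: powr_diff)
    have "(?f has_real_derivative \<nu> * y powr (\<nu> - 1) * bessel_series (\<nu> + 1) (-y)
        + bessel_series (\<nu> + 1 + 1) (-y) / (4 * (\<nu> + 1)) * (- 1) * y powr \<nu>) (at y)"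
      using y assms(1) by (intro derivative_eq_intros | simp)+
    also have "\<nu> * y powr (\<nu> - 1) * bessel_series (\<nu> + 1) (-y)
        + bessel_series (\<nu> + 1 + 1) (-y) / (4 * (\<nu> + 1)) * (- 1) * y powr \<nu>
        = \<nu> * y powr (\<nu> - 1) * bessel_series \<nu> (-y)"
      unfolding p bessel_series_contiguous[OF assms(1), of "-y"] using assms(1)
      by (simp add: add.assoc divide_simps) (simp add: algebra_simps)
    finally have "(?f has_real_derivative \<nu> * y powr (\<nu> - 1) * bessel_series \<nu> (-y)) (at y)" .
    moreover have "\<nu> * y powr (\<nu> - 1) * bessel_series \<nu> (-y) > 0"
      using y assms(1,4) pos[of y] by simp
    ultimately show "\<exists>d. (?f has_real_derivative d) (at y) \<and> d > 0" by blast
  next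
    show "continuous_on {0..x} ?f"
      using assms(1) by (intro continuous_on_mult continuous_on_powr' continuous_on_bessel_series
        continuous_on_id continuous_on_const continuous_on_minus) auto
  qed
  then show ?thesis using \<open>x > 0\<close> assms(1) by (simp add: zero_less_mult_iff)
qed simp

text \<open>
  A comparison argument in the style of Sturm. Write \<open>y(x) = F\<^bsub>\<nu>\<^esub>(-x)\<close>, a solution of
  \<open>4 (x\<^sup>\<nu> y')' = -x\<^bsup>\<nu>-1\<^esup> y\<close>, and take the test function \<open>\<eta>(x) = (R - x)\<^sup>2\<close>, which vanishes
  at \<open>R\<close> together with its derivative. The Wronskian \<open>x\<^sup>\<nu> (y' \<eta> - y \<eta>')\<close> is 0 at both ends of
  \<open>[0, R]\<close>, and its derivative is \<open>-x\<^bsup>\<nu>-1\<^esup> y (4 x \<eta>'' + 4 \<nu> \<eta>' + \<eta>) / 4\<close>. The last factor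
  is positive on \<open>[0, R]\<close> if \<open>R > 2 (\<nu> + 1)\<^sup>2\<close>, so \<open>y\<close> cannot be positive throughout.
\<close>
lemma bessel_series_oscillates:
  assumes "\<nu> > 0"
  shows "\<exists>x>0. bessel_series \<nu> (-x) \<le> 0"
proof (rule ccontr)
  assume "\<not> ?thesis"
  then have pos: "bessel_series \<nu> (-x) > 0" if "x > 0" for x using that by force
  define R where "R = 2 * (\<nu> + 1)\<^sup>2 + 1"
  have "R > 0" by (simp add: R_def add_nonneg_pos)
  let ?f = "\<lambda>x. x powr \<nu> * (- bessel_series (\<nu> + 1) (-x) / (4 * \<nu>) * (R - x)\<^sup>2
                  + 2 * bessel_series \<nu> (-x) * (R - x))"
  have "?f R < ?f 0"
  proof (rule DERIV_neg_imp_decreasing_open[OF \<open>R > 0\<close>])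
    fix y assume y: "0 < y" "y < R"
    have p: "y powr \<nu> = y * y powr (\<nu> - 1)" using y by (simp add: powr_diff)
    let ?D = "\<nu> * y powr (\<nu> - 1) * (- bessel_series (\<nu> + 1) (-y) / (4 * \<nu>) * (R - y)\<^sup>2
                  + 2 * bessel_series \<nu> (-y) * (R - y))
       + y powr \<nu> * (bessel_series (\<nu> + 2) (-y) / (4 * (\<nu> + 1)) / (4 * \<nu>) * (R - y)\<^sup>2
          + bessel_series (\<nu> + 1) (-y) / (4 * \<nu>) * (2 * (R - y))
          - 2 * (bessel_series (\<nu> + 1) (-y) / (4 * \<nu>)) * (R - y) - 2 * bessel_series \<nu> (-y))"
    have "(?f has_real_derivative ?D) (at y)"
      using y assms(1)
      by (auto intro!: derivative_eq_intros simp: add.assoc divide_simps) (simp add: algebra_simps power2_eq_square)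
    also have "?D = - (y powr (\<nu> - 1) / 4 * bessel_series \<nu> (-y) *
        ((R - y)\<^sup>2 - 8 * (\<nu> + 1) * (R - y) + 8 * R))"
    proof -
      let ?a = "bessel_series (\<nu> + 1) (-y)" and ?b = "bessel_series (\<nu> + 2) (-y)"
      have c: "bessel_series \<nu> (-y) = ?a - y * ?b / (4 * \<nu> * (\<nu> + 1))"
        using bessel_series_contiguous[OF assms(1), of "-y"] by simp
      have "?D = y powr (\<nu> - 1) / 4 * (- (?a - y * ?b / (4 * \<nu> * (\<nu> + 1))) * (R - y)\<^sup>2
          + 8 * bessel_series \<nu> (-y) * (\<nu> * (R - y) - y))"
        unfolding p using assms(1) by (simp add: divide_simps) (simp add: algebra_simps)
      also have "\<dots> = - (y powr (\<nu> - 1) / 4 * bessel_series \<nu> (-y) *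
        ((R - y)\<^sup>2 - 8 * (\<nu> + 1) * (R - y) + 8 * R))"
        unfolding c[symmetric] by (simp add: algebra_simps)
      finally show ?thesis .
    qed
    finally have D: "(?f has_real_derivative - (y powr (\<nu> - 1) / 4 * bessel_series \<nu> (-y) *
        ((R - y)\<^sup>2 - 8 * (\<nu> + 1) * (R - y) + 8 * R))) (at y)" .
    \<comment> \<open>Completing the square is what dictates the size of \<open>R\<close>.\<close>
    have "(R - y)\<^sup>2 - 8 * (\<nu> + 1) * (R - y) + 8 * R = (R - y - 4 * (\<nu> + 1))\<^sup>2 + 8"
      by (simp add: R_def power2_eq_square algebra_simps)
    also have "\<dots> > 0" by (simp add: add_nonneg_pos)
    finally show "\<exists>d. (?f has_real_derivative d) (at y) \<and> d < 0"
      using y pos[of y] D by (intro exI conjI) auto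
  next
    show "continuous_on {0..R} ?f"
    proof (rule continuous_on_mult)
      show "continuous_on {0..R} (\<lambda>x. x powr \<nu>)"
        using assms(1) by (intro continuous_on_powr' continuous_on_id continuous_on_const) auto
    qed (use assms(1) in \<open>intro continuous_intros; simp\<close>)
  qed
  then show False by simp
qed

lemma first_zero:
  fixes f :: "real \<Rightarrow> real"
  assumes cont: "continuous_on UNIV f" and "f 0 > 0" and "b > 0" "f b \<le> 0"
  shows "\<exists>q>0. f q = 0 \<and> (\<forall>x. 0 \<le> x \<and> x < q \<longrightarrow> f x > 0)"
proof -
  let ?Z = "{x. 0 \<le> x \<and> f x \<le> 0}"
  define q where "q = Inf ?Z"
  have "closed ?Z"
    by (intro closed_Collect_conj closed_Collect_le continuous_intros cont)
  then have q: "q \<in> ?Z"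
    unfolding q_def
  proof (rule closed_contains_Inf[rotated -1])
    have "b \<in> ?Z" using assms by simp
    then show "?Z \<noteq> {}" by blast
  qed (auto intro: bdd_belowI[of _ 0])
  then have "q > 0" using assms(2) by (cases "q = 0") auto
  have below: "f x > 0" if "0 \<le> x" "x < q" for x
    using cInf_lower[of x ?Z] that unfolding q_def by (force intro: bdd_belowI[of _ 0])
  have "\<exists>x\<ge>0. x \<le> q \<and> f x = 0"
    using q assms(2) \<open>q > 0\<close> continuous_on_subset[OF cont] by (intro IVT2') auto
  then obtain x where "0 \<le> x" "x \<le> q" "f x = 0" by blast
  then have "x = q" using below[of x] by force
  then show ?thesis using \<open>q > 0\<close> \<open>f x = 0\<close> below by blast
qed

section \<open>The positive clamped profile\<close>

text \<open>
  With \<open>\<tau> = T/B\<close>, the functions \<open>F(-s r\<^sup>2)\<close> and \<open>F((s + \<tau>) r\<^sup>2)\<close> solve the equation for the same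
  eigenvalue \<open>B s (s + \<tau>)\<close>; the two boundary conditions for the combination with
  coefficients 1 and \<open>c\<close> are the two equations below. Eliminating \<open>c\<close> leaves one equation
  \<open>H(s) = 0\<close>. Let \<open>q\<close> be the first zero of \<open>F\<^bsub>\<nu>+1\<^esub>(-x)\<close>, that is of \<open>F'(-x)\<close>. For small \<open>s > 0\<close>
  all factors in \<open>H\<close> are positive, while at \<open>q\<close> the first term drops out and
  \<open>F(-q) < 0\<close> by the contiguous relation. The root between gives \<open>c > 0\<close>, and the positivity of
  \<open>F\<^bsub>\<nu>+2\<^esub>\<close> up to \<open>s\<close> is what makes the profile convex.
\<close>
lemma clamped_profile:
  assumes "\<nu> > 0" and "\<tau> \<ge> 0"
  shows "\<exists>s c. s > 0 \<and> c > 0 \<and>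
    bessel_series \<nu> (-s) + c * bessel_series \<nu> (s + \<tau>) = 0 \<and>
    - s * bessel_series (\<nu> + 1) (-s) + c * (s + \<tau>) * bessel_series (\<nu> + 1) (s + \<tau>) = 0 \<and>
    (\<forall>x. 0 \<le> x \<and> x \<le> s \<longrightarrow> bessel_series (\<nu> + 2) (-x) > 0)"
proof -
  let ?F = "bessel_series \<nu>" and ?P = "bessel_series (\<nu> + 1)" and ?Q = "bessel_series (\<nu> + 2)"
  obtain q where q: "q > 0" "?P (-q) = 0" "\<And>x. 0 \<le> x \<Longrightarrow> x < q \<Longrightarrow> ?P (-x) > 0"
    using bessel_series_oscillates[of "\<nu> + 1"] first_zero[of "\<lambda>x. ?P (-x)"] assms(1)
    by (force intro!: continuous_intros)
  have Q: "?Q (-x) > 0" if "0 \<le> x" "x \<le> q" for x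
    using bessel_series_shift_pos[of "\<nu> + 1" q x] q that assms(1) by (simp add: add.assoc)
  have Fq: "?F (-q) < 0"
    using bessel_series_contiguous[OF assms(1), of "-q"] q Q[of q] assms(1)
    by (simp add: mult_pos_pos)
  obtain r where r: "r > 0" "?F (-r) = 0" "\<And>x. 0 \<le> x \<Longrightarrow> x < r \<Longrightarrow> ?F (-x) > 0"
    using first_zero[of "\<lambda>x. ?F (-x)" q] q Fq assms(1) by (force intro!: continuous_intros)
  define \<epsilon> where "\<epsilon> = min r q / 2"
  have \<epsilon>: "0 < \<epsilon>" "\<epsilon> < r" "\<epsilon> < q" using r q by (auto simp: \<epsilon>_def)
  let ?H = "\<lambda>s. s * ?P (-s) * ?F (s + \<tau>) + (s + \<tau>) * ?P (s + \<tau>) * ?F (-s)"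
  have "?H \<epsilon> > 0"
    using \<epsilon> q(3)[of \<epsilon>] r(3)[of \<epsilon>] assms
      bessel_series_pos[of \<nu> "\<epsilon> + \<tau>"] bessel_series_pos[of "\<nu> + 1" "\<epsilon> + \<tau>"]
    by (simp add: add_pos_pos add_pos_nonneg)
  moreover have "?H q < 0"
    using q Fq assms by (simp add: mult_pos_neg bessel_series_pos)
  ultimately have "\<exists>s\<ge>\<epsilon>. s \<le> q \<and> ?H s = 0"
    using \<epsilon> assms by (intro IVT2' continuous_intros) auto
  then obtain s where s: "\<epsilon> \<le> s" "s \<le> q" "?H s = 0" by blast
  with \<open>?H q < 0\<close> have "s < q" by (cases "s = q") auto
  have "s > 0" using s \<epsilon> by simp
  have F: "?F (s + \<tau>) > 0" and P: "?P (s + \<tau>) > 0"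
    using \<open>s > 0\<close> assms by (auto intro!: bessel_series_pos)
  have "s * ?P (-s) * ?F (s + \<tau>) > 0" using q \<open>s < q\<close> \<open>s > 0\<close> F by simp
  then have "(s + \<tau>) * ?P (s + \<tau>) * ?F (-s) < 0" using s(3) by linarith
  moreover have "(s + \<tau>) * ?P (s + \<tau>) > 0" using P \<open>s > 0\<close> assms by simp
  ultimately have neg: "?F (-s) < 0" using mult_less_0_iff by (metis order_less_asym)
  define c where "c = - ?F (-s) / ?F (s + \<tau>)"
  have "c > 0" using neg F by (simp add: c_def divide_neg_pos)
  moreover have "?F (-s) + c * ?F (s + \<tau>) = 0" using F by (simp add: c_def)
  moreover have "- s * ?P (-s) + c * (s + \<tau>) * ?P (s + \<tau>) = 0"
    using s(3) F unfolding c_def by (simp add: divide_simps) (simp add: algebra_simps)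
  ultimately show ?thesis using \<open>s > 0\<close> Q \<open>s < q\<close> by (intro exI[of _ s] exI[of _ c]) auto
qed

text \<open>
  A strictly convex function lies above its tangent at 1, which here is the zero function.
\<close>
lemma pos_of_tangent_convex:
  fixes g g' g'' :: "real \<Rightarrow> real"
  assumes "\<And>t. 0 \<le> t \<Longrightarrow> t \<le> 1 \<Longrightarrow> (g has_real_derivative g' t) (at t)"
    and "\<And>t. 0 \<le> t \<Longrightarrow> t \<le> 1 \<Longrightarrow> (g' has_real_derivative g'' t) (at t)"
    and "\<And>t. 0 \<le> t \<Longrightarrow> t \<le> 1 \<Longrightarrow> g'' t > 0" and "g 1 = 0" "g' 1 = 0" and "0 \<le> t" "t < 1"
  shows "g t > 0"
proof -
  have neg: "g' y < 0" if "0 \<le> y" "y < 1" for y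
  proof -
    have "g' y < g' 1"
    proof (rule DERIV_pos_imp_increasing[OF that(2)])
      fix x assume "y \<le> x" "x \<le> 1"
      then show "\<exists>d. (g' has_real_derivative d) (at x) \<and> d > 0"
        using that assms(2,3)[of x] by (intro exI[of _ "g'' x"]) simp
    qed
    then show ?thesis using assms(5) by simp
  qed
  have "g 1 < g t"
  proof (rule DERIV_neg_imp_decreasing_open[OF \<open>t < 1\<close>])
    show "continuous_on {t..1} g"
      by (intro continuous_at_imp_continuous_on ballI DERIV_isCont[OF assms(1)]) (use assms(6) in auto)
    fix x assume "t < x" "x < 1"
    then show "\<exists>d. (g has_real_derivative d) (at x) \<and> d < 0"
      using assms(1)[of x] neg[of x] assms(6) by (intro exI[of _ "g' x"]) simp
  qed
  then show ?thesis using assms(4) by simp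
qed

section \<open>The radial equation as a first-order system\<close>

text \<open>
  The equation \<open>\<Delta>\<^sup>2u = \<tau> \<Delta>u + m u\<close> for radial functions in dimension \<open>n + 1\<close>, with
  \<open>p = u'\<close>, \<open>w = \<Delta>u\<close> and \<open>z = w'\<close>. Continuity at 0 with \<open>p 0 = z 0 = 0\<close> expresses that the
  profile comes from a function that is smooth across the origin. The behaviour at 1 is left open;
  the boundary conditions enter separately, as limits.
\<close>
definition radial_system ::
    "nat \<Rightarrow> real \<Rightarrow> real \<Rightarrow> (real \<Rightarrow> real) \<Rightarrow> (real \<Rightarrow> real) \<Rightarrow> (real \<Rightarrow> real) \<Rightarrow> (real \<Rightarrow> real) \<Rightarrow> bool" where
  "radial_system n \<tau> m u p w z \<longleftrightarrow>
     (\<forall>r\<in>{0<..<1}.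
        (u has_real_derivative p r) (at r) \<and>
        (p has_real_derivative w r - real n / r * p r) (at r) \<and>
        (w has_real_derivative z r) (at r) \<and>
        (z has_real_derivative \<tau> * w r + m * u r - real n / r * z r) (at r)) \<and>
     continuous_on {0..<1} u \<and> continuous_on {0..<1} p \<and>
     continuous_on {0..<1} w \<and> continuous_on {0..<1} z \<and> p 0 = 0 \<and> z 0 = 0"

lemma radial_systemD:
  assumes "radial_system n \<tau> m u p w z"
  shows "\<And>r. 0 < r \<Longrightarrow> r < 1 \<Longrightarrow> (u has_real_derivative p r) (at r)"
    "\<And>r. 0 < r \<Longrightarrow> r < 1 \<Longrightarrow> (p has_real_derivative w r - real n / r * p r) (at r)"
    "\<And>r. 0 < r \<Longrightarrow> r < 1 \<Longrightarrow> (w has_real_derivative z r) (at r)"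
    "\<And>r. 0 < r \<Longrightarrow> r < 1 \<Longrightarrow>
       (z has_real_derivative \<tau> * w r + m * u r - real n / r * z r) (at r)"
    "continuous_on {0..<1} u" "continuous_on {0..<1} p"
    "continuous_on {0..<1} w" "continuous_on {0..<1} z" "p 0 = 0" "z 0 = 0"
  using assms by (auto simp: radial_system_def)

lemma radial_system_add_scaled:
  assumes "radial_system n \<tau> m u p w z" and "radial_system n \<tau> m u' p' w' z'"
  shows "radial_system n \<tau> m (\<lambda>r. u r + k * u' r) (\<lambda>r. p r + k * p' r)
           (\<lambda>r. w r + k * w' r) (\<lambda>r. z r + k * z' r)"
  unfolding radial_system_def
proof (intro conjI ballI)
  fix r :: real assume "r \<in> {0<..<1}"
  then have r: "0 < r" "r < 1" by auto
  note D = radial_systemD(1-4)[OF assms(1) r] radial_systemD(1-4)[OF assms(2) r]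
  show "((\<lambda>r. u r + k * u' r) has_real_derivative p r + k * p' r) (at r)"
    by (intro DERIV_add DERIV_cmult D)
  show "((\<lambda>r. w r + k * w' r) has_real_derivative z r + k * z' r) (at r)"
    by (intro DERIV_add DERIV_cmult D)
  show "((\<lambda>r. p r + k * p' r) has_real_derivative
      w r + k * w' r - real n / r * (p r + k * p' r)) (at r)"
    by (rule DERIV_cong[OF DERIV_add[OF D(2) DERIV_cmult[OF D(6)]]]) (simp add: algebra_simps)
  show "((\<lambda>r. z r + k * z' r) has_real_derivative
      \<tau> * (w r + k * w' r) + m * (u r + k * u' r) - real n / r * (z r + k * z' r)) (at r)"
    by (rule DERIV_cong[OF DERIV_add[OF D(4) DERIV_cmult[OF D(8)]]]) (simp add: algebra_simps)
qed (use radial_systemD(5-10)[OF assms(1)] radial_systemD(5-10)[OF assms(2)]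
     in \<open>auto intro!: continuous_intros\<close>)

text \<open>
  Gronwall's inequality for the sum of squares. The singular terms with \<open>n/r\<close> do not spoil it
  because they enter the derivative of the energy with a negative sign. The bound gives
  both uniqueness from the data at the origin and boundedness of \<open>w\<close> and \<open>z\<close> up to \<open>r = 1\<close>,
  although \<open>C\<^sup>1\<close> regularity at the boundary says nothing about second and third derivatives.
\<close>
lemma radial_system_energy_bound:
  assumes "radial_system n \<tau> m u p w z" and "0 \<le> r" "r < 1"
  defines "E \<equiv> \<lambda>r. (u r)\<^sup>2 + (p r)\<^sup>2 + (w r)\<^sup>2 + (z r)\<^sup>2"
  shows "E r \<le> E 0 * exp (3 + \<bar>\<tau>\<bar> + \<bar>m\<bar>)"
proof -
  define C where "C = 3 + \<bar>\<tau>\<bar> + \<bar>m\<bar>"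
  note S = radial_systemD[OF assms(1)]
  have "E r * exp (- C * r) \<le> E 0 * exp (- C * 0)"
  proof (rule DERIV_nonpos_imp_decreasing_open[OF \<open>0 \<le> r\<close>])
    fix x assume "0 < x" "x < r"
    then have x: "0 < x" "x < 1" using assms by auto
    let ?E' = "2 * u x * p x + 2 * p x * (w x - real n / x * p x) + 2 * w x * z x
      + 2 * z x * (\<tau> * w x + m * u x - real n / x * z x)"
    have "(E has_real_derivative ?E') (at x)"
      unfolding E_def by (auto intro!: derivative_eq_intros S(1-4) x)
    then have D: "((\<lambda>r. E r * exp (- C * r)) has_real_derivative (?E' - C * E x) * exp (- C * x)) (at x)"
      by (auto intro!: derivative_eq_intros simp: algebra_simps)
    have young: "2 * a * b \<le> a\<^sup>2 + b\<^sup>2" for a b :: real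
      using sum_squares_bound[of a b] by simp
    have young': "2 * (k * a * b) \<le> \<bar>k\<bar> * (a\<^sup>2 + b\<^sup>2)" for a b k :: real
    proof -
      have "2 * (k * a * b) \<le> \<bar>k\<bar> * (2 * \<bar>a\<bar> * \<bar>b\<bar>)"
        using abs_ge_self[of "k * a * b"] by (simp add: abs_mult)
      also have "\<dots> \<le> \<bar>k\<bar> * (a\<^sup>2 + b\<^sup>2)"
        using young[of "\<bar>a\<bar>" "\<bar>b\<bar>"] by (intro mult_left_mono) auto
      finally show ?thesis .
    qed
    have "?E' = 2 * u x * p x + 2 * p x * w x + 2 * w x * z x + 2 * (\<tau> * z x * w x)
        + 2 * (m * z x * u x) - 2 * real n / x * ((p x)\<^sup>2 + (z x)\<^sup>2)"
      by (simp add: algebra_simps power2_eq_square)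
    also have "\<dots> \<le> ((u x)\<^sup>2 + (p x)\<^sup>2) + ((p x)\<^sup>2 + (w x)\<^sup>2) + ((w x)\<^sup>2 + (z x)\<^sup>2)
        + \<bar>\<tau>\<bar> * ((z x)\<^sup>2 + (w x)\<^sup>2) + \<bar>m\<bar> * ((z x)\<^sup>2 + (u x)\<^sup>2) - 0"
      using x by (intro add_mono diff_mono young young') auto
    also have "\<dots> \<le> C * E x"
    proof -
      have "\<bar>\<tau>\<bar> * ((z x)\<^sup>2 + (w x)\<^sup>2) \<le> \<bar>\<tau>\<bar> * E x" "\<bar>m\<bar> * ((z x)\<^sup>2 + (u x)\<^sup>2) \<le> \<bar>m\<bar> * E x"
        by (auto simp: E_def intro!: mult_left_mono)
      moreover have "((u x)\<^sup>2 + (p x)\<^sup>2) + ((p x)\<^sup>2 + (w x)\<^sup>2) + ((w x)\<^sup>2 + (z x)\<^sup>2) \<le> 3 * E x"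
        unfolding E_def distrib_left
        using zero_le_power2[of "u x"] zero_le_power2[of "p x"] zero_le_power2[of "w x"]
          zero_le_power2[of "z x"] by linarith
      ultimately show ?thesis unfolding C_def distrib_right by linarith
    qed
    finally have "(?E' - C * E x) * exp (- C * x) \<le> 0"
      by (simp add: mult_nonpos_nonneg)
    with D show "\<exists>d. ((\<lambda>r. E r * exp (- C * r)) has_real_derivative d) (at x) \<and> d \<le> 0" by blast
  next
    show "continuous_on {0..r} (\<lambda>r. E r * exp (- C * r))"
      unfolding E_def using assms(3)
      by (intro continuous_intros continuous_on_subset[OF S(5)] continuous_on_subset[OF S(6)]
          continuous_on_subset[OF S(7)] continuous_on_subset[OF S(8)]) auto
  qed
  then have "E r \<le> E 0 * exp (C * r)"
    by (simp add: exp_minus field_simps)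
  also have "\<dots> \<le> E 0 * exp C"
    using assms(2,3) by (intro mult_left_mono) (auto simp: C_def E_def intro!: mult_left_le)
  finally show ?thesis by (simp add: C_def)
qed

lemma radial_system_eq_0:
  assumes "radial_system n \<tau> m u p w z" and "u 0 = 0" "w 0 = 0" and "0 \<le> r" "r < 1"
  shows "u r = 0"
proof -
  have "(u r)\<^sup>2 + (p r)\<^sup>2 + (w r)\<^sup>2 + (z r)\<^sup>2 \<le> 0"
    using radial_system_energy_bound[OF assms(1,4,5)] radial_systemD(9,10)[OF assms(1)] assms(2,3)
    by simp
  then show ?thesis by (smt (verit) zero_le_power2 zero_eq_power2)
qed

lemma radial_system_bounded:
  assumes "radial_system n \<tau> m u p w z"
  shows "\<exists>M. \<forall>r. 0 \<le> r \<and> r < 1 \<longrightarrow> \<bar>w r\<bar> \<le> M \<and> \<bar>z r\<bar> \<le> M"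
proof -
  let ?M = "((u 0)\<^sup>2 + (p 0)\<^sup>2 + (w 0)\<^sup>2 + (z 0)\<^sup>2) * exp (3 + \<bar>\<tau>\<bar> + \<bar>m\<bar>)"
  have "\<bar>w r\<bar> \<le> sqrt ?M \<and> \<bar>z r\<bar> \<le> sqrt ?M" if "0 \<le> r" "r < 1" for r
  proof -
    have "(w r)\<^sup>2 \<le> ?M" "(z r)\<^sup>2 \<le> ?M"
      using radial_system_energy_bound[OF assms that] by (smt (verit) zero_le_power2)+
    then show ?thesis by (auto intro!: real_le_rsqrt)
  qed
  then show ?thesis by blast
qed

lemma tendsto_bounded_mult_0:
  fixes w u :: "real \<Rightarrow> real"
  assumes "\<And>r. 0 \<le> r \<Longrightarrow> r < 1 \<Longrightarrow> \<bar>w r\<bar> \<le> M" and "(u \<longlongrightarrow> 0) (at_left 1)"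
  shows "((\<lambda>r. w r * u r) \<longlongrightarrow> 0) (at_left 1)"
proof (rule Lim_null_comparison)
  have "eventually (\<lambda>r::real. r \<in> {0<..<1}) (at_left 1)"
    by (rule eventually_at_left_real) simp
  then show "\<forall>\<^sub>F r in at_left 1. norm (w r * u r) \<le> M * \<bar>u r\<bar>"
    by eventually_elim (auto simp: abs_mult intro!: mult_right_mono assms(1))
  show "((\<lambda>r. M * \<bar>u r\<bar>) \<longlongrightarrow> 0) (at_left 1)"
    using tendsto_mult[OF tendsto_const tendsto_rabs[OF assms(2)], of M] by simp
qed

text \<open>
  Green's identity. The boundary form
  \<open>K = r\<^sup>n (z u' - w p' + w' p - z' u - \<tau> (p u' - u p'))\<close> has the derivative
  \<open>(m - m') r\<^sup>n u u'\<close>, where the primes only tell the two solutions apart. It vanishes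
  at 0 by regularity, and tends to 0 at 1, since each term is a product of a bounded factor and
  one that tends to 0. So \<open>K\<close> cannot be strictly increasing.
\<close>
lemma clamped_radial_system_not_less:
  assumes S: "radial_system n \<tau> m u p w z" and S': "radial_system n \<tau> m' u' p' w' z'"
    and lim: "(u \<longlongrightarrow> 0) (at_left 1)" "(p \<longlongrightarrow> 0) (at_left 1)"
      "(u' \<longlongrightarrow> 0) (at_left 1)" "(p' \<longlongrightarrow> 0) (at_left 1)"
    and pos: "\<And>r. 0 \<le> r \<Longrightarrow> r < 1 \<Longrightarrow> u r > 0" "\<And>r. 0 \<le> r \<Longrightarrow> r < 1 \<Longrightarrow> u' r > 0"
  shows "\<not> m' < m"
proof
  assume less: "m' < m"
  note D = radial_systemD[OF S] and D' = radial_systemD[OF S']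
  obtain M where M: "\<And>r. 0 \<le> r \<Longrightarrow> r < 1 \<Longrightarrow> \<bar>w r\<bar> \<le> M" "\<And>r. 0 \<le> r \<Longrightarrow> r < 1 \<Longrightarrow> \<bar>z r\<bar> \<le> M"
    using radial_system_bounded[OF S] by blast
  obtain M' where M': "\<And>r. 0 \<le> r \<Longrightarrow> r < 1 \<Longrightarrow> \<bar>w' r\<bar> \<le> M'" "\<And>r. 0 \<le> r \<Longrightarrow> r < 1 \<Longrightarrow> \<bar>z' r\<bar> \<le> M'"
    using radial_system_bounded[OF S'] by blast
  define X where "X r = z r * u' r - w r * p' r + w' r * p r - z' r * u r
    - \<tau> * (p r * u' r - u r * p' r)" for r
  define K where "K r = r ^ n * X r" for r
  have DK: "(K has_real_derivative (m - m') * r ^ n * (u r * u' r)) (at r)" if "0 < r" "r < 1" for r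
  proof -
    have DX: "(X has_real_derivative (m - m') * (u r * u' r) - real n / r * X r) (at r)"
      unfolding X_def
      by (rule DERIV_cong, (rule derivative_intros D(1-4)[OF that] D'(1-4)[OF that])+)
        (simp add: algebra_simps)
    have "real n * r ^ (n - Suc 0) = real n / r * r ^ n"
      using that by (cases n) auto
    then show ?thesis
      unfolding K_def
      by (intro DERIV_cong[OF DERIV_mult[OF DERIV_pow DX]]) (simp add: algebra_simps)
  qed
  have "(K \<longlongrightarrow> 1 ^ n * (0 - 0 + 0 - 0 - \<tau> * (0 * 0 - 0 * 0))) (at_left 1)"
    unfolding K_def X_def
    by (intro tendsto_intros lim tendsto_bounded_mult_0[OF M(1)] tendsto_bounded_mult_0[OF M(2)]
        tendsto_bounded_mult_0[OF M'(1)] tendsto_bounded_mult_0[OF M'(2)])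
  then have K1: "(K \<longlongrightarrow> 0) (at_left 1)" by simp
  have incr: "K r < K s" if "0 \<le> r" "r < s" "s < 1" for r s
  proof (rule DERIV_pos_imp_increasing_open[OF \<open>r < s\<close>])
    fix x assume x: "r < x" "x < s"
    then have "(m - m') * x ^ n * (u x * u' x) > 0"
      using that less pos[of x] by simp
    then show "\<exists>d. (K has_real_derivative d) (at x) \<and> d > 0"
      using DK[of x] x that by (intro exI conjI) auto
  next
    show "continuous_on {r..s} K"
      unfolding K_def X_def using that
      by (intro continuous_intros continuous_on_subset[OF D(5)] continuous_on_subset[OF D(6)]
          continuous_on_subset[OF D(7)] continuous_on_subset[OF D(8)]
          continuous_on_subset[OF D'(5)] continuous_on_subset[OF D'(6)]
          continuous_on_subset[OF D'(7)] continuous_on_subset[OF D'(8)]) auto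
  qed
  have "K 0 = 0" unfolding K_def X_def using D(9,10) D'(9,10) by simp
  then have "K (1/2) > 0" using incr[of 0 "1/2"] by simp
  moreover have "K (1/2) \<le> 0"
  proof (rule tendsto_lowerbound[OF K1])
    have "eventually (\<lambda>r::real. r \<in> {1/2<..<1}) (at_left 1)"
      by (rule eventually_at_left_real) simp
    then show "\<forall>\<^sub>F r in at_left 1. K (1/2) \<le> K r"
      by eventually_elim (use incr[of "1/2"] in force)
  qed simp
  ultimately show False by simp
qed

lemma radial_system_bessel_series:
  assumes "l\<^sup>2 = \<tau> * l + m"
  shows "radial_system n \<tau> m
    (\<lambda>r. bessel_series (real (Suc n) / 2) (l * r\<^sup>2))
    (\<lambda>r. l * r / real (Suc n) * bessel_series (real (Suc n) / 2 + 1) (l * r\<^sup>2))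
    (\<lambda>r. l * bessel_series (real (Suc n) / 2) (l * r\<^sup>2))
    (\<lambda>r. l * (l * r / real (Suc n) * bessel_series (real (Suc n) / 2 + 1) (l * r\<^sup>2)))"
proof -
  define \<nu> where "\<nu> = real (Suc n) / 2"
  have \<nu>: "\<nu> > 0" by (simp add: \<nu>_def)
  have d: "real (Suc n) = 2 * \<nu>" "real n = 2 * \<nu> - 1" by (simp_all add: \<nu>_def field_simps)
  let ?F = "\<lambda>r. bessel_series \<nu> (l * r\<^sup>2)"
  let ?G = "\<lambda>r. l * r / (2 * \<nu>) * bessel_series (\<nu> + 1) (l * r\<^sup>2)"
  have F: "(?F has_real_derivative ?G r) (at r)" for r
    using \<nu> by (auto intro!: derivative_eq_intros)
  have G: "(?G has_real_derivative l * ?F r - (2 * \<nu> - 1) / r * ?G r) (at r)" if "r > 0" for r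
  proof -
    have "(?G has_real_derivative l / (2 * \<nu>) * bessel_series (\<nu> + 1) (l * r\<^sup>2)
        + l * r / (2 * \<nu>) * (bessel_series (\<nu> + 2) (l * r\<^sup>2) / (4 * (\<nu> + 1)) * (l * (2 * r)))) (at r)"
      using \<nu>
      by (auto intro!: derivative_eq_intros simp: add.assoc divide_simps) (simp add: algebra_simps)
    also have "l / (2 * \<nu>) * bessel_series (\<nu> + 1) (l * r\<^sup>2)
        + l * r / (2 * \<nu>) * (bessel_series (\<nu> + 2) (l * r\<^sup>2) / (4 * (\<nu> + 1)) * (l * (2 * r)))
      = l * ?F r - (2 * \<nu> - 1) / r * ?G r"
      unfolding bessel_series_contiguous[OF \<nu>, of "l * r\<^sup>2"] using \<nu> that
      by (simp add: divide_simps) (simp add: algebra_simps power2_eq_square)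
    finally show ?thesis .
  qed
  show ?thesis
    unfolding radial_system_def \<nu>_def[symmetric] unfolding d
  proof (intro conjI ballI)
    fix r :: real assume "r \<in> {0<..<1}"
    then have r: "r > 0" by simp
    show "(?F has_real_derivative ?G r) (at r)" by (rule F)
    show "(?G has_real_derivative l * ?F r - (2 * \<nu> - 1) / r * ?G r) (at r)" by (rule G[OF r])
    show "((\<lambda>r. l * ?F r) has_real_derivative l * ?G r) (at r)" by (rule DERIV_cmult[OF F])
    have "\<tau> * (l * ?F r) + m * ?F r = l * (l * ?F r)"
      using arg_cong[OF assms, of "\<lambda>x. x * ?F r"] by (simp add: algebra_simps power2_eq_square)
    then show "((\<lambda>r. l * ?G r) has_real_derivative
        \<tau> * (l * ?F r) + m * ?F r - (2 * \<nu> - 1) / r * (l * ?G r)) (at r)"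
      by (intro DERIV_cong[OF DERIV_cmult[OF G[OF r]]]) (simp add: right_diff_distrib)
  qed (use \<nu> in \<open>auto intro!: continuous_intros\<close>)
qed

section \<open>Partial derivatives on open sets\<close>

lemma partial_eqI: "(f has_derivative D) (at x) \<Longrightarrow> partial i f x = D i"
  unfolding partial_def by (simp add: frechet_derivative_at[symmetric])

lemma has_derivative_cong_open:
  assumes "open S" "x \<in> S" "\<And>y. y \<in> S \<Longrightarrow> f y = g y"
  shows "(f has_derivative D) (at x) \<longleftrightarrow> (g has_derivative D) (at x)"
  using assms has_derivative_transform_within_open[of f D x UNIV S g]
    has_derivative_transform_within_open[of g D x UNIV S f] by auto

lemma partial_cong_open:
  assumes "open S" "x \<in> S" "\<And>y. y \<in> S \<Longrightarrow> f y = g y"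
  shows "partial i f x = partial i g x"
proof -
  have "(f has_derivative D) (at x) \<longleftrightarrow> (g has_derivative D) (at x)" for D
    by (rule has_derivative_cong_open[OF assms])
  then show ?thesis by (simp add: partial_def frechet_derivative_def)
qed

lemma Ck_on_open_cong:
  assumes "open S" "\<And>y. y \<in> S \<Longrightarrow> f y = g y"
  shows "Ck_on_open k f S \<Longrightarrow> Ck_on_open k g S"
  using assms(2)
proof (induction k arbitrary: f g)
  case 0
  then show ?case using continuous_on_cong[of S S f g] by simp
next
  case (Suc k)
  have "Ck_on_open k (partial i g) S" if "i \<in> Basis" for i
    using Suc.IH[of "partial i f" "partial i g"] Suc.prems that
      partial_cong_open[OF assms(1), of _ f g] by simp
  moreover have "g differentiable (at x)" if "x \<in> S" for x
    using Suc.prems(1) that has_derivative_cong_open[OF assms(1) that, of f g] Suc.prems(2)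
    unfolding differentiable_def by (metis Ck_on_open.simps(2) differentiable_def)
  ultimately show ?case by simp
qed

lemma Ck_on_open_SucD: "Ck_on_open (Suc k) f S \<Longrightarrow> Ck_on_open k f S"
proof (induction k arbitrary: f)
  case 0
  then show ?case
    by (auto intro!: continuous_at_imp_continuous_on differentiable_imp_continuous_within)
qed simp

lemma Ck_on_open_mono: "Ck_on_open k f S \<Longrightarrow> l \<le> k \<Longrightarrow> Ck_on_open l f S"
  by (induction k) (auto simp: le_Suc_eq dest: Ck_on_open_SucD simp del: Ck_on_open.simps)

lemma has_derivative_partial:
  "f differentiable (at x) \<Longrightarrow> (f has_derivative (\<lambda>h. partial h f x)) (at x)"
  unfolding partial_def using frechet_derivative_works by fastforce

lemma partial_add:
  assumes "f differentiable (at x)" "g differentiable (at x)"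
  shows "partial i (\<lambda>x. f x + g x) x = partial i f x + partial i g x"
  by (intro partial_eqI[OF has_derivative_add] has_derivative_partial assms)

lemma Ck_on_open_add:
  assumes "open S"
  shows "Ck_on_open k f S \<Longrightarrow> Ck_on_open k g S \<Longrightarrow> Ck_on_open k (\<lambda>x. f x + g x) S"
proof (induction k arbitrary: f g)
  case (Suc k)
  have "Ck_on_open k (partial i (\<lambda>x. f x + g x)) S" if "i \<in> Basis" for i
    by (rule Ck_on_open_cong[OF assms _ Suc.IH[of "partial i f" "partial i g"]])
      (use Suc.prems that partial_add[of f _ g] in auto)
  then show ?case using Suc.prems by auto
qed (auto intro: continuous_intros)

lemma Ck_on_open_zero: "Ck_on_open k (\<lambda>x. 0) S"
proof (induction k)
  case (Suc k)
  have "partial i (\<lambda>x. 0) = (\<lambda>x. 0)" for i :: 'a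
    by (rule ext, rule partial_eqI) (rule has_derivative_const)
  then show ?case using Suc by simp
qed simp

lemma Ck_on_open_sum:
  assumes "open S" "finite I" "\<And>i. i \<in> I \<Longrightarrow> Ck_on_open k (f i) S"
  shows "Ck_on_open k (\<lambda>x. \<Sum>i\<in>I. f i x) S"
  using assms(2,3)
  by (induction I rule: finite_induct) (auto intro: Ck_on_open_zero Ck_on_open_add[OF assms(1)])

lemma Ck_on_open_laplacian:
  assumes "open S" "Ck_on_open (Suc (Suc k)) f S"
  shows "Ck_on_open k (laplacian f) S"
  using assms unfolding laplacian_def[abs_def] by (intro Ck_on_open_sum) auto

section \<open>Radial functions and their profiles\<close>

text \<open>
  A radial function is studied along one coordinate axis \<open>e\<close>. Away from the origin
  \<open>f x = U(\<bar>x\<bar>)\<close> with \<open>U r = f (r e)\<close>, and \<open>U'\<close>, \<open>U''\<close> are partial derivatives of \<open>f\<close> on the axis.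
  The origin itself needs only that \<open>U\<close> is even. The axis is followed into \<open>r < 0\<close>
  for that purpose.
\<close>
context
  fixes f :: "'a::euclidean_space \<Rightarrow> real" and e :: 'a
  assumes radial: "\<forall>x\<in>ball 0 1. \<forall>y\<in>ball 0 1. norm x = norm y \<longrightarrow> f x = f y"
    and C2: "Ck_on_open (Suc (Suc 0)) f (ball 0 1)"
    and e: "e \<in> Basis"
begin

lemma norm_axis: "norm (r *\<^sub>R e) = \<bar>r\<bar>"
  using e by simp

lemma DERIV_along_axis:
  assumes "g differentiable (at (r *\<^sub>R e))"
  shows "((\<lambda>r. g (r *\<^sub>R e)) has_real_derivative partial e g (r *\<^sub>R e)) (at r)"
proof -
  have *: "(g has_derivative frechet_derivative g (at (r *\<^sub>R e))) (at (r *\<^sub>R e))"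
    using assms frechet_derivative_works by blast
  then interpret bounded_linear "frechet_derivative g (at (r *\<^sub>R e))"
    by (rule has_derivative_bounded_linear)
  have "((\<lambda>r. g (r *\<^sub>R e)) has_derivative (\<lambda>h. frechet_derivative g (at (r *\<^sub>R e)) (h *\<^sub>R e))) (at r)"
    by (rule has_derivative_compose[where g = g and f = "\<lambda>r. r *\<^sub>R e"])
      (auto intro!: derivative_eq_intros simp: *)
  then show ?thesis
    by (simp add: has_field_derivative_def partial_def scaleR mult.commute[of _ "frechet_derivative _ _ _"])
qed

lemma DERIV_profile:
  assumes "\<bar>r\<bar> < 1"
  shows "((\<lambda>r. f (r *\<^sub>R e)) has_real_derivative partial e f (r *\<^sub>R e)) (at r)"
    and "((\<lambda>r. partial e f (r *\<^sub>R e)) has_real_derivative partial e (partial e f) (r *\<^sub>R e)) (at r)"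
  using C2 e assms norm_axis by (auto intro!: DERIV_along_axis)

lemma partial_radial:
  assumes "x \<in> ball 0 1" "x \<noteq> 0"
  shows "partial i f x = partial e f (norm x *\<^sub>R e) * ((x \<bullet> i) / norm x)"
proof -
  have D: "((\<lambda>r. f (r *\<^sub>R e)) has_derivative (\<lambda>h. h * partial e f (norm x *\<^sub>R e))) (at (norm x))"
    using DERIV_profile(1)[of "norm x"] assms(1)
    by (auto simp: has_field_derivative_def elim!: has_derivative_eq_rhs)
  have "((\<lambda>y. f (norm y *\<^sub>R e)) has_derivative (\<lambda>h. (h \<bullet> sgn x) * partial e f (norm x *\<^sub>R e))) (at x)"
    using has_derivative_compose[OF has_derivative_norm[OF assms(2)] D] by (simp add: inner_commute)
  moreover have "f (norm y *\<^sub>R e) = f y" if "y \<in> ball 0 1" for y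
    using that e by (intro radial[rule_format]) auto
  ultimately have "(f has_derivative (\<lambda>h. (h \<bullet> sgn x) * partial e f (norm x *\<^sub>R e))) (at x)"
    using has_derivative_cong_open[of "ball 0 1" x "\<lambda>y. f (norm y *\<^sub>R e)" f] assms(1) by simp
  from partial_eqI[OF this, of i] show ?thesis
    by (simp add: sgn_div_norm inner_commute divide_inverse mult_ac)
qed

lemma partial_partial_radial:
  assumes "x \<in> ball 0 1" "x \<noteq> 0"
  shows "partial i (partial i f) x = partial e (partial e f) (norm x *\<^sub>R e) * ((x \<bullet> i) / norm x)\<^sup>2
    + partial e f (norm x *\<^sub>R e) * ((i \<bullet> i) / norm x - (x \<bullet> i)\<^sup>2 / norm x ^ 3)"
proof -
  let ?g = "\<lambda>y. partial e f (norm y *\<^sub>R e) * ((y \<bullet> i) / norm y)"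
  have D: "((\<lambda>r. partial e f (r *\<^sub>R e)) has_derivative
      (\<lambda>h. h * partial e (partial e f) (norm x *\<^sub>R e))) (at (norm x))"
    using DERIV_profile(2)[of "norm x"] assms(1)
    by (auto simp: has_field_derivative_def elim!: has_derivative_eq_rhs)
  have 1: "((\<lambda>y. partial e f (norm y *\<^sub>R e)) has_derivative
      (\<lambda>h. (h \<bullet> sgn x) * partial e (partial e f) (norm x *\<^sub>R e))) (at x)"
    using has_derivative_compose[OF has_derivative_norm[OF assms(2)] D] by (simp add: inner_commute)
  have 2: "((\<lambda>y. (y \<bullet> i) / norm y) has_derivative
      (\<lambda>h. (h \<bullet> i) / norm x - (x \<bullet> i) * (h \<bullet> sgn x) / (norm x)\<^sup>2)) (at x)"
    using assms(2)
    by (auto intro!: derivative_eq_intros has_derivative_norm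
        simp: fun_eq_iff inner_commute power2_eq_square divide_simps)
  have "(?g has_derivative (\<lambda>h. partial e f (norm x *\<^sub>R e) *
        ((h \<bullet> i) / norm x - (x \<bullet> i) * (h \<bullet> sgn x) / (norm x)\<^sup>2)
      + (h \<bullet> sgn x) * partial e (partial e f) (norm x *\<^sub>R e) * ((x \<bullet> i) / norm x))) (at x)"
    by (rule has_derivative_mult[OF 1 2])
  from partial_eqI[OF this, of i]
  have "partial i ?g x = partial e (partial e f) (norm x *\<^sub>R e) * ((x \<bullet> i) / norm x)\<^sup>2
    + partial e f (norm x *\<^sub>R e) * ((i \<bullet> i) / norm x - (x \<bullet> i)\<^sup>2 / norm x ^ 3)"
    by (simp add: sgn_div_norm inner_commute[of i x] divide_inverse power2_eq_square power3_eq_cube mult_ac)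
  moreover have "partial i (partial i f) x = partial i ?g x"
    using assms partial_radial
    by (intro partial_cong_open[where S = "ball 0 1 - {0}"]) (auto intro: open_delete)
  ultimately show ?thesis by simp
qed

lemma laplacian_radial:
  assumes "x \<in> ball 0 1" "x \<noteq> 0"
  shows "laplacian f x = partial e (partial e f) (norm x *\<^sub>R e)
    + real (DIM('a) - 1) / norm x * partial e f (norm x *\<^sub>R e)"
proof -
  let ?U2 = "partial e (partial e f) (norm x *\<^sub>R e)" and ?U1 = "partial e f (norm x *\<^sub>R e)"
  have n: "(\<Sum>i\<in>Basis. (x \<bullet> i)\<^sup>2) = (norm x)\<^sup>2"
    unfolding power2_norm_eq_inner euclidean_inner[of x x] by (simp add: power2_eq_square)
  have "laplacian f x = (\<Sum>i\<in>Basis. ?U2 / (norm x)\<^sup>2 * (x \<bullet> i)\<^sup>2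
      + (?U1 / norm x - ?U1 / norm x ^ 3 * (x \<bullet> i)\<^sup>2))"
    unfolding laplacian_def
    by (intro sum.cong refl) (simp add: partial_partial_radial[OF assms] power_divide right_diff_distrib)
  also have "\<dots> = ?U2 / (norm x)\<^sup>2 * (norm x)\<^sup>2
      + (real DIM('a) * (?U1 / norm x) - ?U1 / norm x ^ 3 * (norm x)\<^sup>2)"
    unfolding sum.distrib sum_subtractf sum_distrib_left[symmetric] n by simp
  also have "\<dots> = ?U2 + real (DIM('a) - 1) / norm x * ?U1"
    using assms(2) DIM_positive[where 'a = 'a]
    by (simp add: of_nat_diff power2_eq_square power3_eq_cube field_simps)
  finally show ?thesis .
qed

text \<open>
  The bilaplacian is treated by applying the results of this section a second time, to the
  Laplacian of the function, which therefore has to be radial again.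
\<close>
lemma laplacian_radial_cong:
  "\<forall>x\<in>ball 0 1. \<forall>y\<in>ball 0 1. norm x = norm y \<longrightarrow> laplacian f x = laplacian f y"
proof (intro ballI impI)
  fix x y :: 'a
  assume xy: "x \<in> ball 0 1" "y \<in> ball 0 1" "norm x = norm y"
  show "laplacian f x = laplacian f y"
  proof (cases "x = 0")
    case False
    then have "y \<noteq> 0" using xy(3) by force
    with False show ?thesis using xy laplacian_radial[of x] laplacian_radial[of y] by simp
  qed (use xy in auto)
qed

lemma radial_profile:
  shows "\<And>r. 0 < r \<Longrightarrow> r < 1 \<Longrightarrow>
      ((\<lambda>r. f (r *\<^sub>R e)) has_real_derivative partial e f (r *\<^sub>R e)) (at r)"
    and "\<And>r. 0 < r \<Longrightarrow> r < 1 \<Longrightarrow> ((\<lambda>r. partial e f (r *\<^sub>R e)) has_real_derivative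
      laplacian f (r *\<^sub>R e) - real (DIM('a) - 1) / r * partial e f (r *\<^sub>R e)) (at r)"
    and "continuous_on {0..<1} (\<lambda>r. f (r *\<^sub>R e))"
    and "continuous_on {0..<1} (\<lambda>r. partial e f (r *\<^sub>R e))"
    and "partial e f 0 = 0"
proof -
  fix r :: real assume r: "0 < r" "r < 1"
  show "((\<lambda>r. f (r *\<^sub>R e)) has_real_derivative partial e f (r *\<^sub>R e)) (at r)"
    using DERIV_profile(1)[of r] r by simp
  have "r *\<^sub>R e \<in> ball 0 1" "r *\<^sub>R e \<noteq> 0" "norm (r *\<^sub>R e) = r"
    using r norm_axis[of r] by auto
  then show "((\<lambda>r. partial e f (r *\<^sub>R e)) has_real_derivative
      laplacian f (r *\<^sub>R e) - real (DIM('a) - 1) / r * partial e f (r *\<^sub>R e)) (at r)"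
    using DERIV_profile(2)[of r] r laplacian_radial[of "r *\<^sub>R e"] by simp
next
  show "continuous_on {0..<1} (\<lambda>r. f (r *\<^sub>R e))" "continuous_on {0..<1} (\<lambda>r. partial e f (r *\<^sub>R e))"
    by (auto intro!: continuous_at_imp_continuous_on DERIV_isCont[OF DERIV_profile(1)]
        DERIV_isCont[OF DERIV_profile(2)])
next
  \<comment> \<open>Reflection turns the derivative at 0 of the even function \<open>?U\<close> into its negative.\<close>
  let ?U = "\<lambda>r. f (r *\<^sub>R e)"
  have 1: "(?U has_real_derivative partial e f 0) (at 0)"
    using DERIV_profile(1)[of 0] by simp
  have "((\<lambda>r. ?U (- r)) has_real_derivative - partial e f 0) (at 0)"
    using DERIV_chain2[of ?U "partial e f 0" uminus 0 "-1"] 1 by (simp add: DERIV_minus[OF DERIV_ident, simplified])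
  moreover have "?U (- r) = ?U r" if "r \<in> {-1<..<1}" for r
    using that e by (intro radial[rule_format]) auto
  ultimately have "(?U has_real_derivative - partial e f 0) (at 0)"
    using has_field_derivative_transform_within_open[of "\<lambda>r. ?U (- r)" _ 0 "{-1<..<1}" ?U] by simp
  from DERIV_unique[OF this 1] show "partial e f 0 = 0" by simp
qed

end

text \<open>
  The two boundary conditions become limits at 1 through the continuous extension \<open>G\<close> of the
  gradient: the profile has the derivative \<open>G(r e) \<bullet> e\<close>, which tends to \<open>G e \<bullet> e\<close>, and this is
  the normal derivative at \<open>e\<close>.
\<close>
lemma radial_eigenfunction_profile:
  fixes \<phi> :: "'a::euclidean_space \<Rightarrow> real"
  assumes B: "B > 0" and eig: "eigenfunction B T \<mu> \<phi>" and rad: "radially_symmetric \<phi>"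
    and e: "e \<in> Basis"
  defines "u \<equiv> \<lambda>r. \<phi> (r *\<^sub>R e)" and "p \<equiv> \<lambda>r. partial e \<phi> (r *\<^sub>R e)"
  shows "\<exists>w z. radial_system (DIM('a) - 1) (T / B) (\<mu> / B) u p w z"
    and "(u \<longlongrightarrow> 0) (at_left 1)" and "(p \<longlongrightarrow> 0) (at_left 1)"
proof -
  let ?w = "\<lambda>r. laplacian \<phi> (r *\<^sub>R e)" and ?z = "\<lambda>r. partial e (laplacian \<phi>) (r *\<^sub>R e)"
  have C4: "Ck_on_open 4 \<phi> (ball 0 1)"
    and eq: "\<And>x. x \<in> ball 0 1 \<Longrightarrow> B * laplacian (laplacian \<phi>) x - T * laplacian \<phi> x = \<mu> * \<phi> x"
    and bc: "\<And>x. norm x = 1 \<Longrightarrow> \<phi> x = 0 \<and> has_outward_normal_derivative \<phi> 0 x"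
    using eig unfolding eigenfunction_def by auto
  have C2: "Ck_on_open (Suc (Suc 0)) \<phi> (ball 0 1)"
    by (rule Ck_on_open_mono[OF C4]) simp
  have C2': "Ck_on_open (Suc (Suc 0)) (laplacian \<phi>) (ball 0 1)"
    using C4 by (intro Ck_on_open_laplacian) (simp_all add: eval_nat_numeral)
  have r1: "\<forall>x\<in>ball 0 1. \<forall>y\<in>ball 0 1. norm x = norm y \<longrightarrow> \<phi> x = \<phi> y"
    using rad unfolding radially_symmetric_def by auto
  note r2 = laplacian_radial_cong[OF r1 C2 e]
  note P = radial_profile[OF r1 C2 e] and P' = radial_profile[OF r2 C2' e]
  have ball: "r *\<^sub>R e \<in> ball 0 1" if "0 \<le> r" "r < 1" for r
    using e that by simp
  have "radial_system (DIM('a) - 1) (T / B) (\<mu> / B) u p ?w ?z"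
    unfolding radial_system_def u_def p_def
  proof (intro conjI ballI)
    fix r :: real assume "r \<in> {0<..<1}"
    then have r: "0 < r" "r < 1" by auto
    show "((\<lambda>r. \<phi> (r *\<^sub>R e)) has_real_derivative partial e \<phi> (r *\<^sub>R e)) (at r)"
      by (rule P(1)[OF r])
    show "((\<lambda>r. partial e \<phi> (r *\<^sub>R e)) has_real_derivative
        laplacian \<phi> (r *\<^sub>R e) - real (DIM('a) - 1) / r * partial e \<phi> (r *\<^sub>R e)) (at r)"
      by (rule P(2)[OF r])
    show "(?w has_real_derivative ?z r) (at r)" by (rule P'(1)[OF r])
    have "laplacian (laplacian \<phi>) (r *\<^sub>R e) = T / B * ?w r + \<mu> / B * \<phi> (r *\<^sub>R e)"
      using eq[OF ball, of r] r B by (simp add: field_simps)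
    then show "(?z has_real_derivative T / B * ?w r + \<mu> / B * \<phi> (r *\<^sub>R e)
        - real (DIM('a) - 1) / r * ?z r) (at r)"
      using P'(2)[OF r] by simp
  next
    show "continuous_on {0..<1} (\<lambda>r. \<phi> (r *\<^sub>R e))" by (rule P(3))
    show "continuous_on {0..<1} (\<lambda>r. partial e \<phi> (r *\<^sub>R e))" by (rule P(4))
    show "continuous_on {0..<1} ?w" by (rule P'(3))
    show "continuous_on {0..<1} ?z" by (rule P'(4))
    show "partial e \<phi> (0 *\<^sub>R e) = 0" using P(5) by simp
    show "?z 0 = 0" using P'(5) by simp
  qed
  then show "\<exists>w z. radial_system (DIM('a) - 1) (T / B) (\<mu> / B) u p w z" by blast

  obtain G where contG: "continuous_on (cball 0 1) G"
    and G: "\<And>x. x \<in> cball 0 1 \<Longrightarrow> (\<phi> has_derivative (\<lambda>h. G x \<bullet> h)) (at x within cball 0 1)"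
    using eig unfolding eigenfunction_def C1_closed_ball_def by blast
  have ne: "norm e = 1" using e by simp
  have lim: "((\<lambda>r. g (r *\<^sub>R e)) \<longlongrightarrow> g e) (at_left 1)" if "continuous_on (cball 0 1) g" for g :: "'a \<Rightarrow> 'b::topological_space"
  proof -
    have cont: "continuous_on {0..1} (\<lambda>r. g (r *\<^sub>R e))"
      using ne by (intro continuous_on_compose2[OF that]) (auto intro!: continuous_intros)
    have "((\<lambda>r. g (r *\<^sub>R e)) \<longlongrightarrow> g (1 *\<^sub>R e)) (at 1 within {0..1})"
      by (rule cont[unfolded continuous_on, rule_format]) simp
    then show ?thesis by (simp add: at_within_Icc_at_left)
  qed
  have "continuous_on (cball 0 1) \<phi>"
    by (rule has_derivative_continuous_on[OF G])
  from lim[OF this] show "(u \<longlongrightarrow> 0) (at_left 1)"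
    using bc[OF ne] by (simp add: u_def)
  have inside: "p r = G (r *\<^sub>R e) \<bullet> e" if "0 < r" "r < 1" for r
  proof -
    have m: "r *\<^sub>R e \<in> ball 0 1" using that by (intro ball) auto
    have "at (r *\<^sub>R e) within cball 0 1 = at (r *\<^sub>R e)"
      by (rule at_within_interior) (use m in simp)
    then have "(\<phi> has_derivative (\<lambda>h. G (r *\<^sub>R e) \<bullet> h)) (at (r *\<^sub>R e))"
      using G[of "r *\<^sub>R e"] m by (metis ball_subset_cball subsetD)
    then show ?thesis unfolding p_def by (rule partial_eqI)
  qed
  have "((\<lambda>t. \<phi> (e + t *\<^sub>R e)) has_derivative (\<lambda>h. G (e + 0 *\<^sub>R e) \<bullet> (h *\<^sub>R e)))
      (at 0 within {-1..0})"
  proof (rule has_derivative_in_compose2[where t = "cball 0 1" and g = \<phi> and g' = "\<lambda>x h. G x \<bullet> h"])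
    show "((\<lambda>t. e + t *\<^sub>R e) has_derivative (\<lambda>h. h *\<^sub>R e)) (at 0 within {-1..0})"
      by (auto intro!: derivative_eq_intros)
    show "(\<lambda>t. e + t *\<^sub>R e) ` {-1..0} \<subseteq> cball 0 1"
    proof
      fix x assume "x \<in> (\<lambda>t. e + t *\<^sub>R e) ` {-1..0}"
      then obtain t where t: "x = e + t *\<^sub>R e" "-1 \<le> t" "t \<le> 0"
        by (metis (no_types, lifting) atLeastAtMost_iff imageE)
      then have "x = (1 + t) *\<^sub>R e" by (simp add: scaleR_left_distrib)
      then show "x \<in> cball 0 1" using ne t by simp
    qed
  qed (use G in auto)
  then have "((\<lambda>t. \<phi> (e + t *\<^sub>R e)) has_real_derivative G e \<bullet> e) (at_left 0)"
    by (auto simp: has_field_derivative_def at_within_Icc_at_left elim!: has_derivative_eq_rhs)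
  moreover have "((\<lambda>t. \<phi> (e + t *\<^sub>R e)) has_real_derivative 0) (at_left 0)"
    using bc[OF ne] by (simp add: has_outward_normal_derivative_def)
  ultimately have "G e \<bullet> e = 0"
    using has_field_derivative_unique[of _ "G e \<bullet> e" 0 "{..<0}" 0] by (simp add: trivial_limit_at_left_real)
  moreover have "((\<lambda>r. G (r *\<^sub>R e) \<bullet> e) \<longlongrightarrow> G e \<bullet> e) (at_left 1)"
    by (intro lim continuous_intros contG)
  moreover have "eventually (\<lambda>r. G (r *\<^sub>R e) \<bullet> e = p r) (at_left 1)"
    using eventually_at_left_real[OF zero_less_one] by eventually_elim (auto simp: inside)
  ultimately show "(p \<longlongrightarrow> 0) (at_left 1)"
    using Lim_transform_eventually by fastforce
qed

section \<open>Bessel profiles on the ball\<close>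

text \<open>
  The algebra generated by the coordinates and the functions \<open>F(l \<bar>x\<bar>\<^sup>2)\<close> of all indices. It is
  closed under partial derivatives, so smoothness of its members is a plain
  induction and no higher derivative has to be computed.
\<close>
inductive bessel_algebra :: "('a::euclidean_space \<Rightarrow> real) \<Rightarrow> bool" where
  bessel: "\<nu> > 0 \<Longrightarrow> bessel_algebra (\<lambda>x. bessel_series \<nu> (l * (x \<bullet> x)))"
| coord: "bessel_algebra (\<lambda>x. x \<bullet> i)"
| const: "bessel_algebra (\<lambda>x. k)"
| add: "bessel_algebra f \<Longrightarrow> bessel_algebra g \<Longrightarrow> bessel_algebra (\<lambda>x. f x + g x)"
| mult: "bessel_algebra f \<Longrightarrow> bessel_algebra g \<Longrightarrow> bessel_algebra (\<lambda>x. f x * g x)"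

lemma has_derivative_bessel_series_inner:
  fixes x :: "'a::euclidean_space"
  assumes "\<nu> > 0"
  shows "((\<lambda>x. bessel_series \<nu> (l * (x \<bullet> x))) has_derivative
    (\<lambda>h. bessel_series (\<nu> + 1) (l * (x \<bullet> x)) * (l / (2 * \<nu>)) * (x \<bullet> h))) (at x)"
proof -
  have 1: "((\<lambda>x. l * (x \<bullet> x)) has_derivative (\<lambda>h. 2 * l * (x \<bullet> h))) (at x)"
    by (auto intro!: derivative_eq_intros simp: inner_commute fun_eq_iff)
  have 2: "(bessel_series \<nu> has_derivative
      (\<lambda>h. bessel_series (\<nu> + 1) (l * (x \<bullet> x)) / (4 * \<nu>) * h)) (at (l * (x \<bullet> x)))"
    using DERIV_bessel_series[OF assms] unfolding has_field_derivative_def .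
  show ?thesis
    by (rule has_derivative_eq_rhs[OF has_derivative_compose[OF 1 2]]) (auto simp: fun_eq_iff)
qed

lemma bessel_algebra_partial:
  assumes "bessel_algebra f"
  shows "f differentiable (at x)" and "bessel_algebra (partial i f)"
proof -
  have "\<exists>D. (\<forall>x. (f has_derivative D x) (at x)) \<and> (\<forall>i. bessel_algebra (\<lambda>x. D x i))"
    using assms
  proof induction
    case (bessel \<nu> l)
    then show ?case
      by (intro exI[of _ "\<lambda>x h. bessel_series (\<nu> + 1) (l * (x \<bullet> x)) * (l / (2 * \<nu>)) * (x \<bullet> h)"])
        (intro conjI allI has_derivative_bessel_series_inner bessel_algebra.mult
          bessel_algebra.bessel bessel_algebra.const bessel_algebra.coord; simp)
  next
    case (coord i)
    show ?case
      by (intro exI[of _ "\<lambda>x h. h \<bullet> i"])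
        (auto intro!: bessel_algebra.intros has_derivative_inner_left has_derivative_ident)
  next
    case (const k)
    show ?case
      by (intro exI[of _ "\<lambda>x h. 0"]) (auto intro!: bessel_algebra.intros)
  next
    case (add f g)
    then obtain D E where "\<forall>x. (f has_derivative D x) (at x)" "\<forall>i. bessel_algebra (\<lambda>x. D x i)"
      "\<forall>x. (g has_derivative E x) (at x)" "\<forall>i. bessel_algebra (\<lambda>x. E x i)" by blast
    then show ?case
      by (intro exI[of _ "\<lambda>x h. D x h + E x h"])
        (auto intro!: bessel_algebra.add has_derivative_add)
  next
    case (mult f g)
    then obtain D E where "\<forall>x. (f has_derivative D x) (at x)" "\<forall>i. bessel_algebra (\<lambda>x. D x i)"
      "\<forall>x. (g has_derivative E x) (at x)" "\<forall>i. bessel_algebra (\<lambda>x. E x i)" by blast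
    with mult show ?case
      by (intro exI[of _ "\<lambda>x h. f x * E x h + D x h * g x"])
        (auto intro!: bessel_algebra.add bessel_algebra.mult has_derivative_mult)
  qed
  then obtain D where D: "\<And>x. (f has_derivative D x) (at x)" "\<And>i. bessel_algebra (\<lambda>x. D x i)"
    by blast
  show "f differentiable (at x)" using D(1) by (rule differentiableI)
  have "partial i f = (\<lambda>x. D x i)"
    using partial_eqI[OF D(1)] by blast
  then show "bessel_algebra (partial i f)" using D(2) by simp
qed

lemma bessel_algebra_continuous: "bessel_algebra f \<Longrightarrow> continuous_on S f"
  by (intro continuous_at_imp_continuous_on ballI differentiable_imp_continuous_within
      bessel_algebra_partial(1))

lemma bessel_algebra_Ck: "bessel_algebra f \<Longrightarrow> Ck_on_open k f S"
  by (induction k arbitrary: f) (auto intro: bessel_algebra_continuous bessel_algebra_partial)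

lemma bessel_algebra_C1_closed_ball:
  assumes "bessel_algebra f"
  shows "C1_closed_ball f"
proof -
  let ?G = "\<lambda>x. \<Sum>i\<in>Basis. partial i f x *\<^sub>R i"
  have "(f has_derivative (\<lambda>h. ?G x \<bullet> h)) (at x within cball 0 1)" for x
  proof -
    have D: "(f has_derivative (\<lambda>h. partial h f x)) (at x)"
      by (intro has_derivative_partial bessel_algebra_partial assms)
    interpret bounded_linear "\<lambda>h. partial h f x"
      using D by (rule has_derivative_bounded_linear)
    have eq: "partial h f x = ?G x \<bullet> h" for h
    proof -
      have "partial h f x = partial (\<Sum>i\<in>Basis. (h \<bullet> i) *\<^sub>R i) f x"
        by (simp add: euclidean_representation)
      also have "\<dots> = ?G x \<bullet> h"
        by (simp add: sum scaleR inner_sum_left inner_commute[of h] mult.commute)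
      finally show ?thesis .
    qed
    show ?thesis
      by (rule has_derivative_eq_rhs[OF has_derivative_at_withinI[OF D]]) (rule ext, rule eq)
  qed
  moreover have "continuous_on (cball 0 1) ?G"
    by (intro continuous_on_sum continuous_on_scaleR continuous_on_const
        bessel_algebra_continuous[OF bessel_algebra_partial(2)[OF assms]])
  ultimately show ?thesis unfolding C1_closed_ball_def by blast
qed

text \<open>
  Summing the second partial derivatives produces the right-hand side of the contiguous relation
  at \<open>\<nu> = d/2\<close>, multiplied by \<open>l\<close>.
\<close>
lemma laplacian_bessel_series:
  "laplacian (\<lambda>x::'a::euclidean_space. bessel_series (real DIM('a) / 2) (l * (x \<bullet> x)))
   = (\<lambda>x. l * bessel_series (real DIM('a) / 2) (l * (x \<bullet> x)))"
proof
  fix x :: 'a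
  define \<nu> where "\<nu> = real DIM('a) / 2"
  have \<nu>: "\<nu> > 0" by (simp add: \<nu>_def)
  let ?f = "\<lambda>x::'a. bessel_series \<nu> (l * (x \<bullet> x))"
  let ?F1 = "bessel_series (\<nu> + 1) (l * (x \<bullet> x))" and ?F2 = "bessel_series (\<nu> + 2) (l * (x \<bullet> x))"
  have p1: "partial i ?f = (\<lambda>x. bessel_series (\<nu> + 1) (l * (x \<bullet> x)) * (l / (2 * \<nu>)) * (x \<bullet> i))" for i
    by (rule ext, rule partial_eqI[OF has_derivative_bessel_series_inner[OF \<nu>]])
  have p2: "partial i (partial i ?f) x = ?F2 * l\<^sup>2 / (4 * \<nu> * (\<nu> + 1)) * (x \<bullet> i)\<^sup>2 + ?F1 * l / (2 * \<nu>)"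
    if "i \<in> Basis" for i
  proof -
    have "((\<lambda>x. bessel_series (\<nu> + 1) (l * (x \<bullet> x))) has_derivative
        (\<lambda>h. ?F2 * (l / (2 * (\<nu> + 1))) * (x \<bullet> h))) (at x)"
      using has_derivative_bessel_series_inner[of "\<nu> + 1" l x] \<nu> by (simp add: add.assoc)
    from has_derivative_mult[OF has_derivative_mult_left[OF this, of "l / (2 * \<nu>)"]
        has_derivative_inner_left[OF has_derivative_ident]]
    have "((\<lambda>x. bessel_series (\<nu> + 1) (l * (x \<bullet> x)) * (l / (2 * \<nu>)) * (x \<bullet> i)) has_derivative
        (\<lambda>h. ?F1 * (l / (2 * \<nu>)) * (h \<bullet> i) +
          ?F2 * (l / (2 * (\<nu> + 1))) * (x \<bullet> h) * (l / (2 * \<nu>)) * (x \<bullet> i))) (at x)" .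
    from partial_eqI[OF this, of i] show ?thesis
      unfolding p1 using that \<nu> by (simp add: inner_Basis power2_eq_square field_simps)
  qed
  have n: "(\<Sum>i\<in>Basis. (x \<bullet> i)\<^sup>2) = x \<bullet> x"
    unfolding euclidean_inner[of x x] by (simp add: power2_eq_square)
  have d: "real DIM('a) = 2 * \<nu>" by (simp add: \<nu>_def)
  have "laplacian ?f x
      = (\<Sum>i\<in>Basis. ?F2 * l\<^sup>2 / (4 * \<nu> * (\<nu> + 1)) * (x \<bullet> i)\<^sup>2 + ?F1 * l / (2 * \<nu>))"
    unfolding laplacian_def by (intro sum.cong refl p2)
  also have "\<dots> = ?F2 * l\<^sup>2 / (4 * \<nu> * (\<nu> + 1)) * (x \<bullet> x) + 2 * \<nu> * (?F1 * l / (2 * \<nu>))"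
    unfolding sum.distrib sum_distrib_left[symmetric] n by (simp add: d)
  also have "\<dots> = l * ?f x"
    unfolding bessel_series_contiguous[OF \<nu>, of "l * (x \<bullet> x)"] using \<nu>
    by (simp add: power2_eq_square divide_simps) (simp add: algebra_simps)
  finally show "laplacian (\<lambda>x. bessel_series (real DIM('a) / 2) (l * (x \<bullet> x))) x
      = l * bessel_series (real DIM('a) / 2) (l * (x \<bullet> x))" by (simp add: \<nu>_def)
qed

lemma partial_linear_combination:
  assumes "bessel_algebra f" "bessel_algebra g"
  shows "partial i (\<lambda>x. a * f x + b * g x) = (\<lambda>x. a * partial i f x + b * partial i g x)"
  by (rule ext, rule partial_eqI,
      intro has_derivative_add has_derivative_mult_right has_derivative_partial
        bessel_algebra_partial assms)

lemma laplacian_linear_combination: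
  assumes "bessel_algebra f" "bessel_algebra g"
  shows "laplacian (\<lambda>x. a * f x + b * g x) = (\<lambda>x. a * laplacian f x + b * laplacian g x)"
  using assms
  by (simp add: laplacian_def fun_eq_iff partial_linear_combination bessel_algebra_partial
      sum.distrib sum_distrib_left)

section \<open>The principal radial eigenvalue\<close>

theorem theorem4p7:
  fixes B T :: real
  assumes "B > 0" and "T \<ge> 0"
  shows "\<exists>\<mu>\<^sub>1 > 0. eigenvalue TYPE('a::euclidean_space) B T \<mu>\<^sub>1 \<and>
    (\<exists>\<phi>\<^sub>1 :: 'a \<Rightarrow> real.
       eigenfunction B T \<mu>\<^sub>1 \<phi>\<^sub>1 \<and> radially_symmetric \<phi>\<^sub>1 \<and> (\<forall>x\<in>ball 0 1. \<phi>\<^sub>1 x > 0) \<and>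
       (\<forall>\<mu>. eigenvalue TYPE('a) B T \<mu> \<and>
            (\<exists>\<phi> :: 'a \<Rightarrow> real. eigenfunction B T \<mu> \<phi> \<and> radially_symmetric \<phi> \<and>
               (\<forall>x\<in>ball 0 1. \<phi> x > 0)) \<longrightarrow> \<mu> = \<mu>\<^sub>1) \<and>
       (\<forall>\<phi> :: 'a \<Rightarrow> real. eigenfunction B T \<mu>\<^sub>1 \<phi> \<and> radially_symmetric \<phi> \<longrightarrow>
            (\<exists>c. \<forall>x\<in>cball 0 1. \<phi> x = c * \<phi>\<^sub>1 x)))"
proof -
  define \<tau> where "\<tau> = T / B"
  define \<nu> where "\<nu> = real DIM('a) / 2"
  have \<tau>: "\<tau> \<ge> 0" "T = B * \<tau>" and \<nu>: "\<nu> > 0" using assms by (auto simp: \<tau>_def \<nu>_def)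
  let ?F = "bessel_series \<nu>" and ?P = "bessel_series (\<nu> + 1)" and ?Q = "bessel_series (\<nu> + 2)"
  obtain s c where s: "s > 0" and c: "c > 0" and bc: "?F (-s) + c * ?F (s + \<tau>) = 0"
    and bc': "- s * ?P (-s) + c * (s + \<tau>) * ?P (s + \<tau>) = 0"
    and Q: "\<And>x. 0 \<le> x \<Longrightarrow> x \<le> s \<Longrightarrow> ?Q (-x) > 0"
    using clamped_profile[OF \<nu> \<tau>(1)] by blast
  \<comment> \<open>The variable of \<open>g\<close> is the squared radius, in which the profile is convex.\<close>
  define g where "g t = ?F (- s * t) + c * ?F ((s + \<tau>) * t)" for t
  define \<phi>1 :: "'a \<Rightarrow> real" where "\<phi>1 x = g (x \<bullet> x)" for x
  define \<mu>1 where "\<mu>1 = B * (s * (s + \<tau>))"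
  have g1: "g 1 = 0" using bc by (simp add: g_def)
  have g_pos: "g t > 0" if "0 \<le> t" "t < 1" for t
  proof -
    let ?g' = "\<lambda>t. (- s * ?P (- s * t) + c * (s + \<tau>) * ?P ((s + \<tau>) * t)) / (4 * \<nu>)"
    let ?g'' = "\<lambda>t. (s\<^sup>2 * ?Q (- s * t) + c * (s + \<tau>)\<^sup>2 * ?Q ((s + \<tau>) * t)) / (16 * \<nu> * (\<nu> + 1))"
    show ?thesis
    proof (rule pos_of_tangent_convex[where g = g and g' = ?g' and g'' = ?g''])
      fix t :: real assume t: "0 \<le> t" "t \<le> 1"
      show "(g has_real_derivative ?g' t) (at t)"
        unfolding g_def[abs_def] using \<nu>
        by (auto intro!: derivative_eq_intros simp: divide_simps)
      show "(?g' has_real_derivative ?g'' t) (at t)"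
        using \<nu> by (auto intro!: derivative_eq_intros simp: add.assoc power2_eq_square divide_simps)
          (simp add: algebra_simps)
      have "?Q (- (s * t)) > 0" using s t by (intro Q) (auto intro: mult_left_le)
      moreover have "?Q ((s + \<tau>) * t) > 0" using s \<tau> t \<nu> by (intro bessel_series_pos) auto
      ultimately show "?g'' t > 0"
        using s c \<nu> \<tau> by (intro divide_pos_pos add_pos_pos mult_pos_pos) auto
    next
      show "(- s * ?P (- s * 1) + c * (s + \<tau>) * ?P ((s + \<tau>) * 1)) / (4 * \<nu>) = 0"
        using bc' by simp
    qed (use g1 that in auto)
  qed
  let ?f1 = "\<lambda>x::'a. ?F (- s * (x \<bullet> x))" and ?f2 = "\<lambda>x::'a. ?F ((s + \<tau>) * (x \<bullet> x))"
  have el: "bessel_algebra ?f1" "bessel_algebra ?f2" by (rule bessel_algebra.bessel[OF \<nu>])+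
  have \<phi>1: "\<phi>1 = (\<lambda>x. 1 * ?f1 x + c * ?f2 x)" by (simp add: \<phi>1_def g_def fun_eq_iff)
  have el1: "bessel_algebra \<phi>1"
    unfolding \<phi>1 by (intro bessel_algebra.add bessel_algebra.mult bessel_algebra.const el)
  have lap: "laplacian ?f1 = (\<lambda>x. - s * ?f1 x)" "laplacian ?f2 = (\<lambda>x. (s + \<tau>) * ?f2 x)"
    using laplacian_bessel_series[where 'a = 'a] by (simp_all only: \<nu>_def)
  have lap1: "laplacian \<phi>1 = (\<lambda>x. - s * ?f1 x + (c * (s + \<tau>)) * ?f2 x)"
    unfolding \<phi>1 laplacian_linear_combination[OF el] lap by (simp add: mult.assoc)
  have lap2: "laplacian (laplacian \<phi>1) = (\<lambda>x. - s * (- s * ?f1 x) + (c * (s + \<tau>)) * ((s + \<tau>) * ?f2 x))"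
    unfolding lap1 laplacian_linear_combination[OF el] lap ..
  have normal: "has_outward_normal_derivative \<phi>1 0 x" if "norm x = 1" for x :: 'a
  proof -
    have "(x + t *\<^sub>R x) \<bullet> (x + t *\<^sub>R x) = (1 + t)\<^sup>2" for t
      using that norm_eq_1[of x] by (simp add: inner_add_left inner_add_right power2_eq_square algebra_simps)
    then have eq: "(\<lambda>t. \<phi>1 (x + t *\<^sub>R x)) = (\<lambda>t. g ((1 + t)\<^sup>2))"
      by (simp add: \<phi>1_def)
    have "((\<lambda>t. g ((1 + t)\<^sup>2)) has_real_derivative
        (- s * ?P (-s) + c * (s + \<tau>) * ?P (s + \<tau>)) / (2 * \<nu>)) (at 0)"
      unfolding g_def using \<nu>
      by (auto intro!: derivative_eq_intros simp: divide_simps)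
    then show ?thesis
      unfolding has_outward_normal_derivative_def eq bc'
      by (simp add: has_field_derivative_at_within)
  qed
  have pos1: "\<phi>1 x > 0" if "x \<in> ball 0 1" for x
  proof -
    have "x \<bullet> x < 1" using that by (simp add: norm_eq_sqrt_inner)
    then show ?thesis unfolding \<phi>1_def by (intro g_pos) auto
  qed
  have eig1: "eigenfunction B T \<mu>1 \<phi>1"
    unfolding eigenfunction_def
  proof (intro conjI ballI)
    show "Ck_on_open 4 \<phi>1 (ball 0 1)" "C1_closed_ball \<phi>1"
      using el1 by (rule bessel_algebra_Ck bessel_algebra_C1_closed_ball)+
    show "\<exists>x\<in>ball 0 1. \<phi>1 x \<noteq> 0" using pos1[of 0] by (intro bexI[of _ 0]) auto
    fix x :: 'a
    show "B * laplacian (laplacian \<phi>1) x - T * laplacian \<phi>1 x = \<mu>1 * \<phi>1 x"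
      unfolding lap2 unfolding lap1 unfolding \<phi>1 \<mu>1_def \<tau>(2) by (simp add: algebra_simps)
  next
    fix x :: 'a assume "x \<in> sphere 0 1"
    then have x: "norm x = 1" by simp
    then show "\<phi>1 x = 0" using g1 by (simp add: \<phi>1_def norm_eq_1)
    show "has_outward_normal_derivative \<phi>1 0 x" by (rule normal[OF x])
  qed
  have rad1: "radially_symmetric \<phi>1"
    unfolding radially_symmetric_def \<phi>1_def by (simp add: norm_eq_sqrt_inner)
  have "\<mu>1 > 0" using assms s \<tau> by (simp add: \<mu>1_def)

  obtain e :: 'a where e: "e \<in> Basis" using nonempty_Basis by blast
  note profile = radial_eigenfunction_profile[OF assms(1) _ _ e]
  have axis: "r *\<^sub>R e \<in> ball 0 1" if "0 \<le> r" "r < 1" for r using e that by simp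
  have unique: "\<mu> = \<mu>1"
    if \<phi>: "eigenfunction B T \<mu> \<phi>" "radially_symmetric \<phi>" "\<forall>x\<in>ball 0 1. \<phi> x > 0"
    for \<mu> and \<phi> :: "'a \<Rightarrow> real"
  proof -
    obtain w z where S: "radial_system (DIM('a) - 1) (T / B) (\<mu> / B)
        (\<lambda>r. \<phi> (r *\<^sub>R e)) (\<lambda>r. partial e \<phi> (r *\<^sub>R e)) w z"
      using profile(1)[OF \<phi>(1,2)] by blast
    obtain w1 z1 where S1: "radial_system (DIM('a) - 1) (T / B) (\<mu>1 / B)
        (\<lambda>r. \<phi>1 (r *\<^sub>R e)) (\<lambda>r. partial e \<phi>1 (r *\<^sub>R e)) w1 z1"
      using profile(1)[OF eig1 rad1] by blast
    note lim = profile(2,3)[OF \<phi>(1,2)] and lim1 = profile(2,3)[OF eig1 rad1]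
    have pos: "\<phi> (r *\<^sub>R e) > 0" "\<phi>1 (r *\<^sub>R e) > 0" if "0 \<le> r" "r < 1" for r
      using axis[OF that] \<phi>(3) pos1 by auto
    have "\<not> \<mu> / B < \<mu>1 / B" "\<not> \<mu>1 / B < \<mu> / B"
      using clamped_radial_system_not_less[OF S1 S lim1 lim] clamped_radial_system_not_less[OF S S1 lim lim1] pos
      by blast+
    then show ?thesis using assms(1) by (simp add: divide_less_cancel)
  qed
  have simple: "\<exists>k. \<forall>x\<in>cball 0 1. \<phi> x = k * \<phi>1 x"
    if \<phi>: "eigenfunction B T \<mu>1 \<phi>" "radially_symmetric \<phi>" for \<phi> :: "'a \<Rightarrow> real"
  proof -
    let ?u = "\<lambda>r. \<phi> (r *\<^sub>R e)"
    obtain w z where S: "radial_system (DIM('a) - 1) \<tau> (s * (s + \<tau>)) ?u (\<lambda>r. partial e \<phi> (r *\<^sub>R e)) w z"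
      using profile(1)[OF \<phi>] assms(1) by (auto simp: \<mu>1_def \<tau>_def)
    have n: "Suc (DIM('a) - 1) = DIM('a)" by simp
    have S1: "(- s)\<^sup>2 = \<tau> * (- s) + s * (s + \<tau>)" and S2: "(s + \<tau>)\<^sup>2 = \<tau> * (s + \<tau>) + s * (s + \<tau>)"
      by (simp_all add: power2_eq_square algebra_simps)
    note S1 = radial_system_bessel_series[OF S1, of "DIM('a) - 1", unfolded n \<nu>_def[symmetric]]
    note S2 = radial_system_bessel_series[OF S2, of "DIM('a) - 1", unfolded n \<nu>_def[symmetric]]
    \<comment> \<open>The combination of the two Bessel profiles that has the values of \<open>\<phi>\<close> and of its
      Laplacian at the origin; the energy bound then forces equality.\<close>
    define b where "b = (w 0 + s * \<phi> 0) / (2 * s + \<tau>)"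
    define a where "a = \<phi> 0 - b"
    have b: "b * (2 * s + \<tau>) = w 0 + s * \<phi> 0" using s \<tau> by (simp add: b_def)
    note D = radial_system_add_scaled[OF radial_system_add_scaled[OF S S1, of "- a"] S2, of "- b"]
    have u: "?u r = a * ?F (- s * r\<^sup>2) + b * ?F ((s + \<tau>) * r\<^sup>2)" if "0 \<le> r" "r < 1" for r
    proof -
      have "?u r + - a * ?F (- s * r\<^sup>2) + - b * ?F ((s + \<tau>) * r\<^sup>2) = 0"
      proof (rule radial_system_eq_0[OF D _ _ that])
        show "?u 0 + - a * ?F (- s * 0\<^sup>2) + - b * ?F ((s + \<tau>) * 0\<^sup>2) = 0"
          by (simp add: a_def)
        show "w 0 + - a * (- s * ?F (- s * 0\<^sup>2)) + - b * ((s + \<tau>) * ?F ((s + \<tau>) * 0\<^sup>2)) = 0"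
          using b by (simp add: a_def algebra_simps)
      qed
      then show ?thesis by simp
    qed
    \<comment> \<open>The condition \<open>\<phi> = 0\<close> on the boundary fixes the ratio of the coefficients.\<close>
    have "(?u \<longlongrightarrow> a * ?F (- s * 1\<^sup>2) + b * ?F ((s + \<tau>) * 1\<^sup>2)) (at_left 1)"
    proof (rule Lim_transform_eventually)
      have "continuous_on UNIV (\<lambda>r. a * ?F (- s * r\<^sup>2) + b * ?F ((s + \<tau>) * r\<^sup>2))"
        using \<nu> by (intro continuous_intros)
      then have "isCont (\<lambda>r. a * ?F (- s * r\<^sup>2) + b * ?F ((s + \<tau>) * r\<^sup>2)) 1"
        by (simp add: continuous_on_eq_continuous_at)
      then show "((\<lambda>r. a * ?F (- s * r\<^sup>2) + b * ?F ((s + \<tau>) * r\<^sup>2)) \<longlongrightarrow>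
          a * ?F (- s * 1\<^sup>2) + b * ?F ((s + \<tau>) * 1\<^sup>2)) (at_left 1)"
        unfolding isCont_def by (rule filterlim_mono) (auto simp: at_le)
      show "\<forall>\<^sub>F r in at_left 1. a * ?F (- s * r\<^sup>2) + b * ?F ((s + \<tau>) * r\<^sup>2) = ?u r"
        using eventually_at_left_real[OF zero_less_one] by eventually_elim (auto simp: u)
    qed
    with profile(2)[OF \<phi>] have "a * ?F (- s) + b * ?F (s + \<tau>) = 0"
      using tendsto_unique[OF trivial_limit_at_left_real] by fastforce
    moreover have "?F (- s) = - c * ?F (s + \<tau>)" using bc by simp
    ultimately have "(b - a * c) * ?F (s + \<tau>) = 0" by (simp add: algebra_simps)
    moreover have "?F (s + \<tau>) > 0" using s \<tau> \<nu> by (intro bessel_series_pos) auto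
    ultimately have "b = a * c" by simp
    have "\<phi> x = a * \<phi>1 x" if "x \<in> cball 0 1" for x
    proof (cases "norm x < 1")
      case True
      have "\<phi> x = ?u (norm x)"
        by (rule \<phi>(2)[unfolded radially_symmetric_def, rule_format]) (use that e in auto)
      also have "\<dots> = a * g ((norm x)\<^sup>2)"
        using u[of "norm x"] True by (simp add: g_def \<open>b = a * c\<close> algebra_simps)
      also have "\<dots> = a * \<phi>1 x" by (simp add: \<phi>1_def power2_norm_eq_inner)
      finally show ?thesis .
    next
      case False
      then have "x \<in> sphere 0 1" using that by simp
      then show ?thesis using eig1 \<phi>(1) unfolding eigenfunction_def by simp
    qed
    then show ?thesis by blast
  qed
  show ?thesis
  proof (rule exI[of _ \<mu>1], intro conjI, goal_cases)
    case 3
    show ?case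
    proof (rule exI[of _ \<phi>1], intro conjI allI impI ballI)
      fix \<mu> assume "eigenvalue TYPE('a) B T \<mu> \<and>
        (\<exists>\<phi> :: 'a \<Rightarrow> real. eigenfunction B T \<mu> \<phi> \<and> radially_symmetric \<phi> \<and> (\<forall>x\<in>ball 0 1. \<phi> x > 0))"
      then show "\<mu> = \<mu>1" using unique by blast
    next
      fix \<phi> :: "'a \<Rightarrow> real" assume "eigenfunction B T \<mu>1 \<phi> \<and> radially_symmetric \<phi>"
      then show "\<exists>c. \<forall>x\<in>cball 0 1. \<phi> x = c * \<phi>1 x" using simple by blast
    qed (fact eig1 rad1 pos1)+
  qed (use \<open>\<mu>1 > 0\<close> eig1 in \<open>auto simp: eigenvalue_def\<close>)
qed

end
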